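(* Let $k$ be a field, $S=k[x_1,\dots,x_n]$, let $I\subset(x_1,\dots,x_n)^2$ be a monomial ideal and $R=S/I$. Then all products of monomial cycles (of homological degree at least one) vanish in the Koszul homology $H_*(K^R)$ if and only if for all $2\le p\le n$, all $1\le q<p$, and all permutations $\pi$ of $\{1,\dots,n\}$, \[ [I:(x_{\pi(1)},\dots,x_{\pi(q)})]\,[I:(x_{\pi(q+1)},\dots,x_{\pi(p)})]\subset B_I^{n,\{\pi(1),\dots,\pi(p)\}} . \]
   Context: Koszul complex: $K^R$ is the Koszul complex of $R$ with respect to $x_1,\dots,x_n$: $K^R_p=\bigwedge^p R^n$, where $R^n$ has basis $e_1,\dots,e_n$. For $\sigma=\{\sigma_1<\dots<\sigma_p\}\subset[n]=\{1,\dots,n\}$ put $e_\sigma=e_{\sigma_1}\wedge\dots\wedge e_{\sigma_p}$; the differential is $\partial(\bar f e_\sigma)=\sum_{j}\operatorname{sgn}(\sigma,\sigma_j)\,\overline{x_{\sigma_j}f}\,e_{\sigma\setminus\sigma_j}$, where $\bar g$ is the image in $R$ of $g\in S$ and $\operatorname{sgn}(\sigma,\sigma_j)=(-1)^{\#\{s\in\sigma:\,s<\sigma_j\}}$. The exterior multiplication makes $K^R$ a differential graded algebra and so induces a product on $H_*(K^R)$. A monomial cycle is a cycle of the form $\bar u e_\sigma$ with $u$ a monomial of $S$. Boundary ideal: let $\binom{[n]}{p}$ be the set of $p$-element subsets of $[n]$. For $1\le p<n$ let $M(n,p)$ be the matrix over $k$ with rows indexed by $\binom{[n]}{p}$ and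 columns indexed by $\binom{[n]}{p+1}$, with $(\sigma,\tau)$ entry equal to $0$ if $\sigma\not\subset\tau$ and to $\operatorname{sgn}(\tau,\tau\setminus\sigma)$ if $\sigma\subset\tau$ (here $\tau\setminus\sigma$ is identified with its unique element). Let $\mathcal C^n_p[k]$ be the collection of all $C\subset\binom{[n]}{p}$ such that the rows of $M(n,p)$ indexed by $C$ form a minimal linearly dependent set over $k$. For $A\subset[n]$ put $x_A=\prod_{a\in A}x_a$. For $\sigma,\sigma'\in\binom{[n]}{p}$ put $I^\sigma_{\sigma'}=x_{\sigma'\setminus\sigma}\,[I:x_{\sigma\setminus\sigma'}]$. For $\sigma\in\binom{[n]}{p}$ with $1\le p<n$ the boundary ideal is $B_I^{n,\sigma}=\bigcap_{C\in\mathcal C^n_p[k],\ \sigma\in C}\ \sum_{\sigma'\in C}I^\sigma_{\sigma'}$, and $B_I^{n,[n]}=I$. *)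

theory Defs
  imports
    "HOL-Library.Poly_Mapping"
    "HOL-Library.FuncSet"
    "HOL-Combinatorics.Permutations"
    "HOL-Algebra.QuotRing"
    "HOL-Algebra.Ideal_Product"
begin

section \<open>Polynomial rings and monomial ideals\<close>

text \<open>A polynomial is a finitely supported map from exponent vectors to coefficients. The ring
  \<open>k[x\<^sub>1, \<dots>, x\<^sub>n]\<close> is carved out as the carrier of a ring record, because the type allows
  a variable for every natural number.\<close>

type_synonym 'k mpoly = "(nat \<Rightarrow>\<^sub>0 nat) \<Rightarrow>\<^sub>0 'k"

definition poly_ring :: "nat \<Rightarrow> 'k::field mpoly ring" where
  "poly_ring n =
    \<lparr>carrier = {f. \<forall>m \<in> Poly_Mapping.keys f. Poly_Mapping.keys m \<subseteq> {1..n}},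
     mult = (*), one = 1, zero = 0, add = (+)\<rparr>"

definition Var :: "nat \<Rightarrow> 'k::field mpoly" where
  "Var i = Poly_Mapping.single (Poly_Mapping.single i 1) 1"

definition monomials :: "nat \<Rightarrow> 'k::field mpoly set" where
  "monomials n = {Poly_Mapping.single m 1 | m. Poly_Mapping.keys m \<subseteq> {1..n}}"

definition monomial_ideal :: "nat \<Rightarrow> 'k::field mpoly set \<Rightarrow> bool" where
  "monomial_ideal n I \<longleftrightarrow> (\<exists>M \<subseteq> monomials n. I = Idl\<^bsub>poly_ring n\<^esub> M)"

definition var_ideal :: "nat \<Rightarrow> nat set \<Rightarrow> 'k::field mpoly set" where
  "var_ideal n A = Idl\<^bsub>poly_ring n\<^esub> (Var ` A)"

definition colon :: "('a, 'b) ring_scheme \<Rightarrow> 'a set \<Rightarrow> 'a set \<Rightarrow> 'a set" where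
  "colon R I J = {a \<in> carrier R. \<forall>b \<in> J. a \<otimes>\<^bsub>R\<^esub> b \<in> I}"


section \<open>The Koszul complex\<close>

text \<open>\<open>koszul_sgn \<sigma> j = (-1)\<^bsup>#{s \<in> \<sigma>. s < j}\<^esup>\<close>, an integer acting on any ring.\<close>

definition koszul_sgn :: "nat set \<Rightarrow> nat \<Rightarrow> int" where
  "koszul_sgn \<sigma> j = (- 1) ^ card {s \<in> \<sigma>. s < j}"

text \<open>The sign in \<open>e\<^sub>\<sigma> \<and> e\<^sub>\<tau> = \<plusminus> e\<^bsub>\<sigma> \<union> \<tau>\<^esub>\<close> for disjoint \<open>\<sigma>\<close>, \<open>\<tau>\<close>.\<close>

definition wedge_sgn :: "nat set \<Rightarrow> nat set \<Rightarrow> int" where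
  "wedge_sgn \<sigma> \<tau> = (- 1) ^ card {(s, t). s \<in> \<sigma> \<and> t \<in> \<tau> \<and> t < s}"

text \<open>The exterior algebra of \<open>R\<^sup>n\<close>: the element \<open>\<Sum>\<^sub>\<sigma> c\<^sub>\<sigma> e\<^sub>\<sigma>\<close> is represented by its coefficient
  function \<open>c\<close>, which lives on the subsets of \<open>[n]\<close>. The summand of degree \<open>p\<close> consists of the
  functions that vanish outside the \<open>p\<close>-element subsets.\<close>

definition koszul_algebra :: "('a, 'b) ring_scheme \<Rightarrow> nat \<Rightarrow> (nat set \<Rightarrow> 'a) ring" where
  "koszul_algebra R n =
    \<lparr>carrier = Pow {1..n} \<rightarrow>\<^sub>E carrier R,
     mult = (\<lambda>c d. \<lambda>\<rho> \<in> Pow {1..n}.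
       \<Oplus>\<^bsub>R\<^esub>\<sigma> \<in> Pow \<rho>. [wedge_sgn \<sigma> (\<rho> - \<sigma>)] \<cdot>\<^bsub>R\<^esub> (c \<sigma> \<otimes>\<^bsub>R\<^esub> d (\<rho> - \<sigma>))),
     one = (\<lambda>\<rho> \<in> Pow {1..n}. if \<rho> = {} then \<one>\<^bsub>R\<^esub> else \<zero>\<^bsub>R\<^esub>),
     zero = (\<lambda>\<rho> \<in> Pow {1..n}. \<zero>\<^bsub>R\<^esub>),
     add = (\<lambda>c d. \<lambda>\<rho> \<in> Pow {1..n}. c \<rho> \<oplus>\<^bsub>R\<^esub> d \<rho>)\<rparr>"

definition koszul_elem :: "('a, 'b) ring_scheme \<Rightarrow> nat \<Rightarrow> 'a \<Rightarrow> nat set \<Rightarrow> nat set \<Rightarrow> 'a" where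
  "koszul_elem R n a \<sigma> = (\<lambda>\<rho> \<in> Pow {1..n}. if \<rho> = \<sigma> then a else \<zero>\<^bsub>R\<^esub>)"

text \<open>The basis vector \<open>e\<^sub>\<rho>\<close> occurs in \<open>\<partial>e\<^sub>\<sigma>\<close> exactly when \<open>\<sigma> = \<rho> \<union> {j}\<close> for some \<open>j \<notin> \<rho>\<close>, with
  coefficient \<open>koszul_sgn \<sigma> j \<cdot> x\<^sub>j\<close>.\<close>

definition koszul_diff ::
  "('a, 'b) ring_scheme \<Rightarrow> nat \<Rightarrow> (nat \<Rightarrow> 'a) \<Rightarrow> (nat set \<Rightarrow> 'a) \<Rightarrow> nat set \<Rightarrow> 'a" where
  "koszul_diff R n x c = (\<lambda>\<rho> \<in> Pow {1..n}.
    \<Oplus>\<^bsub>R\<^esub>j \<in> {1..n} - \<rho>. [koszul_sgn (insert j \<rho>) j] \<cdot>\<^bsub>R\<^esub> (x j \<otimes>\<^bsub>R\<^esub> c (insert j \<rho>)))"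

definition koszul_cycles ::
  "('a, 'b) ring_scheme \<Rightarrow> nat \<Rightarrow> (nat \<Rightarrow> 'a) \<Rightarrow> (nat set \<Rightarrow> 'a) set" where
  "koszul_cycles R n x =
    {c \<in> carrier (koszul_algebra R n). koszul_diff R n x c = \<zero>\<^bsub>koszul_algebra R n\<^esub>}"

definition koszul_boundaries ::
  "('a, 'b) ring_scheme \<Rightarrow> nat \<Rightarrow> (nat \<Rightarrow> 'a) \<Rightarrow> (nat set \<Rightarrow> 'a) set" where
  "koszul_boundaries R n x = koszul_diff R n x ` carrier (koszul_algebra R n)"

text \<open>The total homology \<open>H\<^sub>* = \<Oplus>\<^sub>p H\<^sub>p\<close>. By the Leibniz rule the cycles form a ring in which the
  boundaries are an ideal, and the quotient ring carries the induced product.\<close>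

definition koszul_homology ::
  "('a, 'b) ring_scheme \<Rightarrow> nat \<Rightarrow> (nat \<Rightarrow> 'a) \<Rightarrow> (nat set \<Rightarrow> 'a) set ring" where
  "koszul_homology R n x =
    (koszul_algebra R n)\<lparr>carrier := koszul_cycles R n x\<rparr> Quot koszul_boundaries R n x"

definition homology_class ::
  "('a, 'b) ring_scheme \<Rightarrow> nat \<Rightarrow> (nat \<Rightarrow> 'a) \<Rightarrow> (nat set \<Rightarrow> 'a) \<Rightarrow> (nat set \<Rightarrow> 'a) set" where
  "homology_class R n x c = koszul_boundaries R n x +>\<^bsub>koszul_algebra R n\<^esub> c"


section \<open>Monomial cycles over \<open>R = S/I\<close>\<close>

abbreviation quot_ring :: "nat \<Rightarrow> 'k::field mpoly set \<Rightarrow> 'k mpoly set ring" where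
  "quot_ring n I \<equiv> poly_ring n Quot I"

definition residue :: "nat \<Rightarrow> 'k::field mpoly set \<Rightarrow> 'k mpoly \<Rightarrow> 'k mpoly set" where
  "residue n I f = I +>\<^bsub>poly_ring n\<^esub> f"

definition var_residue :: "nat \<Rightarrow> 'k::field mpoly set \<Rightarrow> nat \<Rightarrow> 'k mpoly set" where
  "var_residue n I i = residue n I (Var i)"

definition monomial_cycles ::
  "nat \<Rightarrow> 'k::field mpoly set \<Rightarrow> nat \<Rightarrow> (nat set \<Rightarrow> 'k mpoly set) set" where
  "monomial_cycles n I p =
    {z \<in> koszul_cycles (quot_ring n I) n (var_residue n I).
      \<exists>u \<in> monomials n. \<exists>\<sigma> \<subseteq> {1..n}. card \<sigma> = p \<and>
        z = koszul_elem (quot_ring n I) n (residue n I u) \<sigma>}"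


section \<open>Boundary ideals\<close>

definition subsets_of_card :: "nat \<Rightarrow> nat \<Rightarrow> nat set set" where
  "subsets_of_card n p = {\<sigma>. \<sigma> \<subseteq> {1..n} \<and> card \<sigma> = p}"

text \<open>The entry for \<open>\<sigma> \<in> subsets_of_card n p\<close> and \<open>\<tau> \<in> subsets_of_card n (p + 1)\<close>;
  then \<open>\<tau> - \<sigma>\<close> is a singleton whenever \<open>\<sigma> \<subseteq> \<tau>\<close>.\<close>

definition bd_matrix :: "nat set \<Rightarrow> nat set \<Rightarrow> 'k::field" where
  "bd_matrix \<sigma> \<tau> = (if \<sigma> \<subseteq> \<tau> then of_int (koszul_sgn \<tau> (the_elem (\<tau> - \<sigma>))) else 0)"

text \<open>Linear dependence of the rows indexed by \<open>C\<close> is meant for the family of rows: equal rows with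
  different indices are dependent. The library's \<open>dependent\<close>, a property of the set of rows,
  would identify them.\<close>

definition rows_dependent :: "'k::field itself \<Rightarrow> nat \<Rightarrow> nat \<Rightarrow> nat set set \<Rightarrow> bool" where
  "rows_dependent _ n p C \<longleftrightarrow>
    (\<exists>a :: nat set \<Rightarrow> 'k. (\<exists>\<sigma> \<in> C. a \<sigma> \<noteq> 0) \<and>
      (\<forall>\<tau> \<in> subsets_of_card n (p + 1). (\<Sum>\<sigma> \<in> C. a \<sigma> * bd_matrix \<sigma> \<tau>) = 0))"

definition circuits :: "'k::field itself \<Rightarrow> nat \<Rightarrow> nat \<Rightarrow> nat set set set" where
  "circuits k n p =
    {C. C \<subseteq> subsets_of_card n p \<and> rows_dependent k n p C \<and>
      (\<forall>D. D \<subset> C \<longrightarrow> \<not> rows_dependent k n p D)}"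

definition shifted_colon ::
  "nat \<Rightarrow> 'k::field mpoly set \<Rightarrow> nat set \<Rightarrow> nat set \<Rightarrow> 'k mpoly set" where
  "shifted_colon n I \<sigma> \<sigma>' =
    (\<lambda>f. prod Var (\<sigma>' - \<sigma>) * f) ` colon (poly_ring n) I {prod Var (\<sigma> - \<sigma>')}"

definition ideal_sum :: "('a, 'b) ring_scheme \<Rightarrow> 'i set \<Rightarrow> ('i \<Rightarrow> 'a set) \<Rightarrow> 'a set" where
  "ideal_sum R A J = {\<Oplus>\<^bsub>R\<^esub>i \<in> A. f i | f. f \<in> (\<Pi> i \<in> A. J i)}"

definition boundary_ideal ::
  "nat \<Rightarrow> 'k::field mpoly set \<Rightarrow> nat set \<Rightarrow> 'k mpoly set" where
  "boundary_ideal n I \<sigma> =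
    (if \<sigma> = {1..n} then I
     else carrier (poly_ring n) \<inter>
       (\<Inter>C \<in> {C \<in> circuits TYPE('k) n (card \<sigma>). \<sigma> \<in> C}.
         ideal_sum (poly_ring n) C (shifted_colon n I \<sigma>)))"

end

theory Submission
  imports Defs
begin

text \<open>The Koszul complex of \<open>S/I\<close> is graded by exponent vectors. In the degree of \<open>x\<^sup>\<mu> e\<^sub>\<rho>\<close> the complex over
  \<open>S\<close> is the chain complex of a simplex, and passing to \<open>S/I\<close> kills the basis elements \<open>x\<^sup>\<nu> e\<^sub>\<sigma>\<close> with
  \<open>x\<^sup>\<nu> \<in> I\<close>. So \<open>x\<^sup>\<mu> e\<^sub>\<rho>\<close> is a boundary iff some chain over \<open>k\<close> has a boundary that agrees with
  \<open>e\<^sub>\<rho>\<close> at every \<open>\<sigma>\<close> outside the killed set. By linear algebra this fails exactly when some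
  minimal linear dependency among the rows of \<open>M(n,p)\<close> involves \<open>\<rho>\<close> and avoids the killed set, which
  says \<open>x\<^sup>\<mu> \<notin> B\<^sub>I\<^bsup>n,\<rho>\<^esup>\<close>. The product of the monomial cycles \<open>u e\<^sub>\<sigma>\<close> and \<open>v e\<^sub>\<tau>\<close> is
  \<open>\<plusminus> u v e\<^bsub>\<sigma> \<union> \<tau>\<^esub>\<close> or zero, with \<open>u\<close> and \<open>v\<close> in the colon ideals of the variables in \<open>\<sigma>\<close> and \<open>\<tau>\<close>,
  and all ideals involved are spanned by monomials.\<close>


section \<open>Signs\<close>

text \<open>The ideal I^\<rho>_\<sigma> is made for the multigrading: x^\<mu> lies in it exactly
  when the monomial that e_\<sigma> carries in the degree of x^\<mu> e_\<rho> lies in I. A sum over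
  a circuit thus asks that the circuit meet the killed set, and the intersection asks this of every
  circuit through \<rho>. The obstacle is that circuits are taken over all of [n], whereas a degree
  only involves the faces of its support A. A face outside A is never killed, so a chain on [n] that
  solves the boundary equation has its boundary supported on A. This boundary is a cycle and can be
  filled again inside A, an acyclic simplex because \<rho> is nonempty. A second difficulty is that
  homology lives in nested quotients of records. All computations use polynomial chains, where
  equality over S/I becomes a difference in \<open>monomial_span U\<close>. The product in the
  quotient is a union over all representatives, so its vanishing needs the Leibniz rule.\<close>

lemma koszul_sgn_insert_same: "koszul_sgn (insert j \<rho>) j = koszul_sgn \<rho> j"
proof -
  have "{s \<in> insert j \<rho>. s < j} = {s \<in> \<rho>. s < j}" by auto
  then show ?thesis by (simp add: koszul_sgn_def)
qed

lemma koszul_sgn_Un: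
  assumes "finite \<alpha>" "finite \<beta>" "\<alpha> \<inter> \<beta> = {}"
  shows "koszul_sgn (\<alpha> \<union> \<beta>) j = koszul_sgn \<alpha> j * koszul_sgn \<beta> j"
proof -
  have "{s \<in> \<alpha> \<union> \<beta>. s < j} = {s \<in> \<alpha>. s < j} \<union> {s \<in> \<beta>. s < j}" by auto
  moreover have "card ({s \<in> \<alpha>. s < j} \<union> {s \<in> \<beta>. s < j}) = card {s \<in> \<alpha>. s < j} + card {s \<in> \<beta>. s < j}"
    using assms by (intro card_Un_disjoint) auto
  ultimately show ?thesis by (simp add: koszul_sgn_def power_add)
qed

lemma koszul_sgn_insert:
  assumes "finite \<rho>" "k \<notin> \<rho>"
  shows "koszul_sgn (insert k \<rho>) j = (if k < j then - koszul_sgn \<rho> j else koszul_sgn \<rho> j)"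
proof -
  have "{s \<in> insert k \<rho>. s < j} = (if k < j then insert k {s \<in> \<rho>. s < j} else {s \<in> \<rho>. s < j})" by auto
  then show ?thesis using assms by (simp add: koszul_sgn_def)
qed

lemma koszul_sgn_square: "koszul_sgn \<rho> j * koszul_sgn \<rho> j = 1"
  by (simp add: koszul_sgn_def flip: power_mult_distrib)

lemma koszul_sgn_cases: "koszul_sgn \<rho> j = 1 \<or> koszul_sgn \<rho> j = -1"
  unfolding koszul_sgn_def by (simp add: minus_one_power_iff)

lemma wedge_sgn_cases: "wedge_sgn \<sigma> \<tau> = 1 \<or> wedge_sgn \<sigma> \<tau> = -1"
  unfolding wedge_sgn_def by (simp add: minus_one_power_iff)

lemma wedge_sgn_insert_left:
  assumes "finite \<sigma>" "finite \<tau>" "j \<notin> \<sigma>"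
  shows "wedge_sgn (insert j \<sigma>) \<tau> = wedge_sgn \<sigma> \<tau> * koszul_sgn \<tau> j"
proof -
  let ?A = "{(s, t). s \<in> \<sigma> \<and> t \<in> \<tau> \<and> t < s}" and ?B = "{t \<in> \<tau>. t < j}"
  have "{(s, t). s \<in> insert j \<sigma> \<and> t \<in> \<tau> \<and> t < s} = ?A \<union> Pair j ` ?B" by auto
  moreover have "finite ?A"
    by (rule finite_subset[of _ "\<sigma> \<times> \<tau>"]) (use assms in auto)
  moreover have "?A \<inter> Pair j ` ?B = {}" using assms by auto
  moreover have "card (Pair j ` ?B) = card ?B" by (intro card_image) (auto simp: inj_on_def)
  ultimately have "card {(s, t). s \<in> insert j \<sigma> \<and> t \<in> \<tau> \<and> t < s} = card ?A + card ?B"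
    using assms by (simp add: card_Un_disjoint)
  then show ?thesis by (simp add: koszul_sgn_def wedge_sgn_def power_add)
qed

text \<open>The new inversions are the elements of \<sigma> above \<open>j\<close>, that is,
  \<open>card \<sigma>\<close> minus those below \<open>j\<close>. This is where the sign
  \<open>(-1) ^ card \<sigma>\<close> of the Leibniz rule comes from.\<close>

lemma wedge_sgn_insert_right:
  assumes "finite \<sigma>" "finite \<tau>" "j \<notin> \<sigma>" "j \<notin> \<tau>"
  shows "wedge_sgn \<sigma> (insert j \<tau>) = wedge_sgn \<sigma> \<tau> * ((-1) ^ card \<sigma> * koszul_sgn \<sigma> j)"
proof -
  let ?A = "{(s, t). s \<in> \<sigma> \<and> t \<in> \<tau> \<and> t < s}" and ?B = "{s \<in> \<sigma>. j < s}"
  have "{(s, t). s \<in> \<sigma> \<and> t \<in> insert j \<tau> \<and> t < s} = ?A \<union> (\<lambda>s. (s, j)) ` ?B" by auto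
  moreover have "finite ?A"
    by (rule finite_subset[of _ "\<sigma> \<times> \<tau>"]) (use assms in auto)
  moreover have "?A \<inter> (\<lambda>s. (s, j)) ` ?B = {}" using assms by auto
  moreover have "card ((\<lambda>s. (s, j)) ` ?B) = card ?B" by (intro card_image) (auto simp: inj_on_def)
  ultimately have 1: "card {(s, t). s \<in> \<sigma> \<and> t \<in> insert j \<tau> \<and> t < s} = card ?A + card ?B"
    using assms by (simp add: card_Un_disjoint)
  have "\<sigma> = ?B \<union> {s \<in> \<sigma>. s < j}" using assms(3) by (auto simp: not_less order_le_less)
  moreover have "card (?B \<union> {s \<in> \<sigma>. s < j}) = card ?B + card {s \<in> \<sigma>. s < j}"
    using assms(1) by (intro card_Un_disjoint) auto
  ultimately have 2: "card \<sigma> = card ?B + card {s \<in> \<sigma>. s < j}" by simp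
  have "(-1::int) ^ card \<sigma> * koszul_sgn \<sigma> j = (-1) ^ card ?B"
    unfolding 2 power_add using koszul_sgn_square[of \<sigma> j] by (simp add: koszul_sgn_def)
  then show ?thesis by (simp only: wedge_sgn_def 1 power_add mult.assoc)
qed


section \<open>The Koszul differential over a commutative ring\<close>

text \<open>Kept generic in the ring and in \<open>x\<close>: with \<open>Var\<close> it is the
  Koszul differential on polynomial chains, with the constant 1 the augmented simplicial boundary
  over k. The sign may omit the inserted \<open>j\<close> because \<open>j\<close> is not below
  itself.\<close>

definition kdiff :: "nat \<Rightarrow> (nat \<Rightarrow> 'a::comm_ring_1) \<Rightarrow> (nat set \<Rightarrow> 'a) \<Rightarrow> nat set \<Rightarrow> 'a" where
  "kdiff n x c \<rho> = (\<Sum>j\<in>{1..n} - \<rho>. of_int (koszul_sgn \<rho> j) * (x j * c (insert j \<rho>)))"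

definition kmult :: "(nat set \<Rightarrow> 'a::comm_ring_1) \<Rightarrow> (nat set \<Rightarrow> 'a) \<Rightarrow> nat set \<Rightarrow> 'a" where
  "kmult c d \<rho> = (\<Sum>\<sigma>\<in>Pow \<rho>. of_int (wedge_sgn \<sigma> (\<rho> - \<sigma>)) * (c \<sigma> * d (\<rho> - \<sigma>)))"

text \<open>Each pair \<open>j\<close>, \<open>k\<close> contributes in both orders. Inserting one
  index first flips the sign of the other only if it is the smaller one, so the two contributions
  are opposite.\<close>

lemma kdiff_kdiff:
  assumes "finite \<rho>"
  shows "kdiff n x (kdiff n x c) \<rho> = 0"
proof -
  let ?N = "{1..n} - \<rho>"
  define g where "g j k = of_int (koszul_sgn \<rho> j * koszul_sgn \<rho> k) *
    (x j * x k * c (insert j (insert k \<rho>)))" for j k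
  have g: "g j k = g k j" for j k by (simp add: g_def mult_ac insert_commute)
  have "kdiff n x (kdiff n x c) \<rho> =
      (\<Sum>j\<in>?N. \<Sum>k\<in>?N - {j}. if j < k then - g j k else g j k)"
    unfolding kdiff_def
  proof (intro sum.cong refl)
    fix j assume j: "j \<in> ?N"
    have N: "{1..n} - insert j \<rho> = ?N - {j}" by auto
    show "of_int (koszul_sgn \<rho> j) *
        (x j * (\<Sum>k\<in>{1..n} - insert j \<rho>. of_int (koszul_sgn (insert j \<rho>) k) * (x k * c (insert k (insert j \<rho>)))))
      = (\<Sum>k\<in>?N - {j}. if j < k then - g j k else g j k)"
      unfolding N sum_distrib_left
    proof (intro sum.cong refl)
      fix k
      have i: "insert k (insert j \<rho>) = insert j (insert k \<rho>)" by (rule insert_commute)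
      show "of_int (koszul_sgn \<rho> j) * (x j * (of_int (koszul_sgn (insert j \<rho>) k) * (x k * c (insert k (insert j \<rho>)))))
        = (if j < k then - g j k else g j k)"
        unfolding i g_def using j assms by (simp add: koszul_sgn_insert mult_ac)
    qed
  qed
  \<comment> \<open>Passing to the full square adds only the diagonal, where both conditions fail;
    after that the two summations can be exchanged.\<close>
  also have "\<dots> = (\<Sum>j\<in>?N. \<Sum>k\<in>?N. (if k < j then g j k else 0) - (if j < k then g j k else 0))"
    by (intro sum.cong refl sum.mono_neutral_cong_left) auto
  also have "\<dots> = (\<Sum>j\<in>?N. \<Sum>k\<in>?N. if k < j then g j k else 0) - (\<Sum>j\<in>?N. \<Sum>k\<in>?N. if j < k then g j k else 0)"
    by (simp add: sum_subtractf)
  also have "(\<Sum>j\<in>?N. \<Sum>k\<in>?N. if k < j then g j k else 0) = (\<Sum>k\<in>?N. \<Sum>j\<in>?N. if k < j then g j k else 0)"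
    by (rule sum.swap)
  also have "\<dots> = (\<Sum>j\<in>?N. \<Sum>k\<in>?N. if j < k then g j k else 0)"
    by (intro sum.cong refl) (simp add: g)
  finally show ?thesis by simp
qed

text \<open>On the left, e_\<rho> arises from splittings of \<open>insert j \<rho>\<close> with
  \<open>j\<close> outside \<rho>. The right side has additional terms in which both factors contain
  \<open>j\<close>. They belong to products of basis vectors that share \<open>j\<close>, which are
  zero in the exterior algebra, and they cancel in pairs.\<close>

lemma kdiff_kmult:
  assumes "\<rho> \<subseteq> {1..n}"
  shows "kdiff n x (kmult c d) \<rho> =
    kmult (kdiff n x c) d \<rho> + kmult (\<lambda>\<sigma>. (-1) ^ card \<sigma> * c \<sigma>) (kdiff n x d) \<rho>"
proof -
  have fin: "finite \<rho>" using assms finite_subset by blast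
  \<comment> \<open>\<open>T1\<close> removes \<open>j\<close> from the left factor,
    \<open>T2\<close> from the right one. For \<open>j\<close> outside \<rho> these are the genuine
    terms, for \<open>j\<close> inside \<rho> the spurious ones.\<close>
  define T1 where "T1 \<alpha> j = of_int (wedge_sgn \<alpha> (\<rho> - \<alpha>) * koszul_sgn \<alpha> j) *
    (x j * c (insert j \<alpha>) * d (\<rho> - \<alpha>))" for \<alpha> j
  define T2 where "T2 \<alpha> j = of_int (wedge_sgn \<alpha> (\<rho> - \<alpha>) * ((-1) ^ card \<alpha> * koszul_sgn (\<rho> - \<alpha>) j)) *
    (x j * c \<alpha> * d (insert j (\<rho> - \<alpha>)))" for \<alpha> j
  have lhs: "kdiff n x (kmult c d) \<rho> = (\<Sum>j\<in>{1..n} - \<rho>. \<Sum>\<alpha>\<in>Pow \<rho>. T1 \<alpha> j + T2 \<alpha> j)"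
    unfolding kdiff_def
  proof (intro sum.cong refl)
    fix j assume "j \<in> {1..n} - \<rho>"
    then have j: "j \<notin> \<rho>" by simp
    define h where "h \<sigma> = of_int (wedge_sgn \<sigma> (insert j \<rho> - \<sigma>)) * (c \<sigma> * d (insert j \<rho> - \<sigma>))" for \<sigma>
    have inj: "inj_on (insert j) (Pow \<rho>)"
      by (rule inj_onI) (metis PowD insert_ident j subsetD)
    have "kmult c d (insert j \<rho>) = (\<Sum>\<sigma>\<in>Pow \<rho> \<union> insert j ` Pow \<rho>. h \<sigma>)"
      by (simp add: kmult_def h_def Pow_insert)
    also have "\<dots> = (\<Sum>\<sigma>\<in>Pow \<rho>. h \<sigma>) + (\<Sum>\<sigma>\<in>insert j ` Pow \<rho>. h \<sigma>)"
      using fin j by (intro sum.union_disjoint) auto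
    also have "\<dots> = (\<Sum>\<sigma>\<in>Pow \<rho>. h (insert j \<sigma>) + h \<sigma>)"
      using inj by (simp add: sum.reindex sum.distrib add.commute)
    finally have "of_int (koszul_sgn \<rho> j) * (x j * kmult c d (insert j \<rho>))
      = (\<Sum>\<sigma>\<in>Pow \<rho>. of_int (koszul_sgn \<rho> j) * (x j * (h (insert j \<sigma>) + h \<sigma>)))"
      by (simp add: sum_distrib_left)
    also have "\<dots> = (\<Sum>\<alpha>\<in>Pow \<rho>. T1 \<alpha> j + T2 \<alpha> j)"
    proof (intro sum.cong refl)
      fix \<alpha> assume "\<alpha> \<in> Pow \<rho>"
      then have a: "\<alpha> \<subseteq> \<rho>" by simp
      define \<beta> where "\<beta> = \<rho> - \<alpha>"
      have f: "finite \<alpha>" "finite \<beta>" "j \<notin> \<alpha>" "j \<notin> \<beta>" "\<alpha> \<inter> \<beta> = {}"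
        using a j fin finite_subset by (auto simp: \<beta>_def)
      have "\<rho> = \<alpha> \<union> \<beta>" using a by (auto simp: \<beta>_def)
      then have s: "koszul_sgn \<rho> j = koszul_sgn \<alpha> j * koszul_sgn \<beta> j"
        using f by (simp add: koszul_sgn_Un)
      have s1: "koszul_sgn \<rho> j * wedge_sgn (insert j \<alpha>) \<beta> = wedge_sgn \<alpha> \<beta> * koszul_sgn \<alpha> j"
        using f koszul_sgn_square[of \<beta> j] by (simp add: s wedge_sgn_insert_left)
      have s2: "koszul_sgn \<rho> j * wedge_sgn \<alpha> (insert j \<beta>) = wedge_sgn \<alpha> \<beta> * ((-1) ^ card \<alpha> * koszul_sgn \<beta> j)"
        using f koszul_sgn_square[of \<alpha> j] by (simp add: s wedge_sgn_insert_right)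
      have e1: "insert j \<rho> - insert j \<alpha> = \<beta>" and e2: "insert j \<rho> - \<alpha> = insert j \<beta>"
        using j a by (auto simp: \<beta>_def)
      show "of_int (koszul_sgn \<rho> j) * (x j * (h (insert j \<alpha>) + h \<alpha>)) = T1 \<alpha> j + T2 \<alpha> j"
        unfolding h_def T1_def T2_def \<beta>_def[symmetric] e1 e2 s1[symmetric] s2[symmetric]
        by (simp add: algebra_simps)
    qed
    finally show "of_int (koszul_sgn \<rho> j) * (x j * kmult c d (insert j \<rho>)) = (\<Sum>\<alpha>\<in>Pow \<rho>. T1 \<alpha> j + T2 \<alpha> j)" .
  qed
  have r1: "kmult (kdiff n x c) d \<rho> = (\<Sum>\<alpha>\<in>Pow \<rho>. (\<Sum>j\<in>{1..n} - \<rho>. T1 \<alpha> j) + (\<Sum>j\<in>\<rho> - \<alpha>. T1 \<alpha> j))"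
    unfolding kmult_def
  proof (intro sum.cong refl)
    fix \<alpha> assume "\<alpha> \<in> Pow \<rho>"
    then have "{1..n} - \<alpha> = ({1..n} - \<rho>) \<union> (\<rho> - \<alpha>)" using assms by auto
    then have "(\<Sum>j\<in>{1..n} - \<alpha>. T1 \<alpha> j) = (\<Sum>j\<in>{1..n} - \<rho>. T1 \<alpha> j) + (\<Sum>j\<in>\<rho> - \<alpha>. T1 \<alpha> j)"
      by (simp only:) (rule sum.union_disjoint, use fin in auto)
    moreover have "of_int (wedge_sgn \<alpha> (\<rho> - \<alpha>)) * (kdiff n x c \<alpha> * d (\<rho> - \<alpha>)) = (\<Sum>j\<in>{1..n} - \<alpha>. T1 \<alpha> j)"
      by (simp add: kdiff_def T1_def sum_distrib_left sum_distrib_right mult_ac)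
    ultimately show "of_int (wedge_sgn \<alpha> (\<rho> - \<alpha>)) * (kdiff n x c \<alpha> * d (\<rho> - \<alpha>)) =
      (\<Sum>j\<in>{1..n} - \<rho>. T1 \<alpha> j) + (\<Sum>j\<in>\<rho> - \<alpha>. T1 \<alpha> j)" by simp
  qed
  have r2: "kmult (\<lambda>\<sigma>. (-1) ^ card \<sigma> * c \<sigma>) (kdiff n x d) \<rho> =
      (\<Sum>\<alpha>\<in>Pow \<rho>. (\<Sum>j\<in>{1..n} - \<rho>. T2 \<alpha> j) + (\<Sum>j\<in>\<alpha>. T2 \<alpha> j))"
    unfolding kmult_def
  proof (intro sum.cong refl)
    fix \<alpha> assume a: "\<alpha> \<in> Pow \<rho>"
    then have "{1..n} - (\<rho> - \<alpha>) = ({1..n} - \<rho>) \<union> \<alpha>" using assms by auto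
    moreover have "finite \<alpha>" using a fin finite_subset by auto
    ultimately have "(\<Sum>j\<in>{1..n} - (\<rho> - \<alpha>). T2 \<alpha> j) = (\<Sum>j\<in>{1..n} - \<rho>. T2 \<alpha> j) + (\<Sum>j\<in>\<alpha>. T2 \<alpha> j)"
      by (simp only:) (rule sum.union_disjoint, use a in auto)
    moreover have "of_int (wedge_sgn \<alpha> (\<rho> - \<alpha>)) * ((-1) ^ card \<alpha> * c \<alpha> * kdiff n x d (\<rho> - \<alpha>)) = (\<Sum>j\<in>{1..n} - (\<rho> - \<alpha>). T2 \<alpha> j)"
      by (simp add: kdiff_def T2_def sum_distrib_left mult_ac)
    ultimately show "of_int (wedge_sgn \<alpha> (\<rho> - \<alpha>)) * ((-1) ^ card \<alpha> * c \<alpha> * kdiff n x d (\<rho> - \<alpha>)) =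
      (\<Sum>j\<in>{1..n} - \<rho>. T2 \<alpha> j) + (\<Sum>j\<in>\<alpha>. T2 \<alpha> j)" by simp
  qed
  \<comment> \<open>The spurious \<open>T1\<close> term at \<alpha> and the \<open>T2\<close> term
    at \<open>insert j \<alpha>\<close> contain the same product of
    \<open>c (insert j \<alpha>)\<close> and \<open>d (\<rho> - \<alpha>)\<close>, with opposite
    signs.\<close>
  have "(\<Sum>\<alpha>\<in>Pow \<rho>. \<Sum>j\<in>\<rho> - \<alpha>. T1 \<alpha> j) = (\<Sum>(\<alpha>, j)\<in>Sigma (Pow \<rho>) (\<lambda>\<alpha>. \<rho> - \<alpha>). T1 \<alpha> j)"
    using fin by (subst sum.Sigma) auto
  also have "\<dots> = (\<Sum>(\<beta>, j)\<in>Sigma (Pow \<rho>) (\<lambda>\<beta>. \<beta>). - T2 \<beta> j)"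
  proof (rule sum.reindex_bij_witness[where i = "\<lambda>(\<beta>, j). (\<beta> - {j}, j)" and j = "\<lambda>(\<alpha>, j). (insert j \<alpha>, j)"], goal_cases)
    case (5 p)
    then obtain \<alpha> j where p: "p = (\<alpha>, j)" and a: "\<alpha> \<subseteq> \<rho>" and j: "j \<in> \<rho>" "j \<notin> \<alpha>" by auto
    define \<beta> where "\<beta> = \<rho> - insert j \<alpha>"
    have e: "\<rho> - \<alpha> = insert j \<beta>" "insert j (\<rho> - insert j \<alpha>) = insert j \<beta>" using a j by (auto simp: \<beta>_def)
    have f: "finite \<alpha>" "finite \<beta>" "j \<notin> \<beta>" using fin a finite_subset by (auto simp: \<beta>_def)
    have s1: "wedge_sgn \<alpha> (insert j \<beta>) * koszul_sgn \<alpha> j = wedge_sgn \<alpha> \<beta> * (-1) ^ card \<alpha>"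
      using f j koszul_sgn_square[of \<alpha> j] by (simp add: wedge_sgn_insert_right)
    have s2: "wedge_sgn (insert j \<alpha>) \<beta> * ((-1) ^ card (insert j \<alpha>) * koszul_sgn \<beta> j) = - (wedge_sgn \<alpha> \<beta> * (-1) ^ card \<alpha>)"
      using f j koszul_sgn_square[of \<beta> j] by (simp add: wedge_sgn_insert_left)
    show ?case unfolding p prod.case T1_def T2_def e \<beta>_def[symmetric] s1 s2 by simp
  qed auto
  also have "\<dots> = - (\<Sum>\<alpha>\<in>Pow \<rho>. \<Sum>j\<in>\<alpha>. T2 \<alpha> j)"
    using fin by (subst sum.Sigma) (auto simp: sum_negf case_prod_unfold intro: finite_subset)
  finally have can: "(\<Sum>\<alpha>\<in>Pow \<rho>. \<Sum>j\<in>\<rho> - \<alpha>. T1 \<alpha> j) = - (\<Sum>\<alpha>\<in>Pow \<rho>. \<Sum>j\<in>\<alpha>. T2 \<alpha> j)" .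
  have "kdiff n x (kmult c d) \<rho> = (\<Sum>\<alpha>\<in>Pow \<rho>. \<Sum>j\<in>{1..n} - \<rho>. T1 \<alpha> j + T2 \<alpha> j)"
    unfolding lhs by (rule sum.swap)
  then show ?thesis unfolding r1 r2 by (simp add: sum.distrib can)
qed


section \<open>Circuits and solvability of the boundary equation\<close>

text \<open>The Fredholm alternative. With \<open>v\<close> the row of \<rho> and \<open>D\<close>
  the other rows that are not killed, a combination leads to a circuit, while a separating
  functional is a chain whose boundary is 1 at \<rho> and 0 at the rows in \<open>D\<close>.\<close>

lemma span_or_separate:
  fixes M :: "'i \<Rightarrow> 'j \<Rightarrow> 'k::field"
  assumes "finite D" "finite T"
  shows "(\<exists>c. \<forall>t\<in>T. v t = (\<Sum>s\<in>D. c s * M s t)) \<or>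
    (\<exists>a. (\<forall>s\<in>D. (\<Sum>t\<in>T. M s t * a t) = 0) \<and> (\<Sum>t\<in>T. v t * a t) = 1)"
  using assms(1)
proof (induction D arbitrary: v rule: finite_induct)
  case empty
  show ?case
  proof (cases "\<forall>t\<in>T. v t = 0")
    case False
    then obtain t0 where t0: "t0 \<in> T" "v t0 \<noteq> 0" by auto
    have "(\<Sum>t\<in>T. v t * (if t = t0 then 1 / v t0 else 0)) = 1"
      using t0 assms(2) by (simp add: if_distrib[where f = "(*) _"] cong: if_cong)
    then show ?thesis by auto
  qed auto
next
  case (insert d D)
  have ext: "(\<Sum>s\<in>insert d D. (c(d := e)) s * M s t) = e * M d t + (\<Sum>s\<in>D. c s * M s t)" for c e t
    using insert.hyps by (auto intro!: sum.cong)
  show ?case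
  \<comment> \<open>The question is whether row \<open>d\<close> lies outside the span of
    \<open>D\<close>. If it does not, every functional that vanishes on \<open>D\<close> vanishes on
    \<open>d\<close> too.\<close>
  proof (cases "\<exists>a. (\<forall>s\<in>D. (\<Sum>t\<in>T. M s t * a t) = 0) \<and> (\<Sum>t\<in>T. M d t * a t) = 1")
    case False
    then obtain c where c: "\<forall>t\<in>T. M d t = (\<Sum>s\<in>D. c s * M s t)"
      using insert.IH[of "M d"] by auto
    have "(\<Sum>t\<in>T. M d t * a t) = 0" if "\<forall>s\<in>D. (\<Sum>t\<in>T. M s t * a t) = 0" for a
    proof -
      have "(\<Sum>t\<in>T. M d t * a t) = (\<Sum>t\<in>T. \<Sum>s\<in>D. c s * (M s t * a t))"
        using c by (auto simp: sum_distrib_right mult.assoc intro!: sum.cong)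
      also have "\<dots> = (\<Sum>s\<in>D. c s * (\<Sum>t\<in>T. M s t * a t))"
        by (subst sum.swap) (simp add: sum_distrib_left)
      finally show ?thesis using that by simp
    qed
    moreover have "\<exists>c'. \<forall>t\<in>T. v t = (\<Sum>s\<in>insert d D. c' s * M s t)"
      if "\<forall>t\<in>T. v t = (\<Sum>s\<in>D. c s * M s t)" for c
      unfolding that[rule_format] by (intro exI[of _ "c(d := 0)"]) (simp only: ext, simp add: that)
    ultimately show ?thesis using insert.IH[of v] by (metis insert_iff)
  next
    case True
    then obtain a0 where a0: "\<forall>s\<in>D. (\<Sum>t\<in>T. M s t * a0 t) = 0" "(\<Sum>t\<in>T. M d t * a0 t) = 1" by auto
    define e where "e = (\<Sum>t\<in>T. v t * a0 t)"
    \<comment> \<open>Subtracting \<open>e\<close> times row \<open>d\<close> makes the vector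
      invisible to \<open>a0\<close>. A functional \<open>a1\<close> separating the remainder is
      corrected by a multiple of \<open>a0\<close> so that it vanishes on row \<open>d\<close> as
      well.\<close>
    from insert.IH[of "\<lambda>t. v t - e * M d t"] show ?thesis
    proof (elim disjE exE conjE)
      fix c assume c: "\<forall>t\<in>T. v t - e * M d t = (\<Sum>s\<in>D. c s * M s t)"
      have "\<forall>t\<in>T. v t = (\<Sum>s\<in>insert d D. (c(d := e)) s * M s t)"
        unfolding ext using c by (simp add: diff_eq_eq add.commute)
      then show ?thesis by blast
    next
      fix a1 assume a1: "\<forall>s\<in>D. (\<Sum>t\<in>T. M s t * a1 t) = 0" "(\<Sum>t\<in>T. (v t - e * M d t) * a1 t) = 1"
      define f where "f = (\<Sum>t\<in>T. M d t * a1 t)"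
      have lin: "(\<Sum>t\<in>T. w t * (a1 t - f * a0 t)) = (\<Sum>t\<in>T. w t * a1 t) - f * (\<Sum>t\<in>T. w t * a0 t)" for w
        by (simp add: algebra_simps sum_subtractf sum_distrib_left)
      have "(\<Sum>t\<in>T. v t * a1 t) - e * f = 1"
        using a1(2) by (simp add: f_def algebra_simps sum_subtractf sum_distrib_left)
      then have "(\<Sum>t\<in>T. v t * (a1 t - f * a0 t)) = 1"
        unfolding lin e_def[symmetric] by (simp only: mult.commute)
      moreover have "\<forall>s\<in>insert d D. (\<Sum>t\<in>T. M s t * (a1 t - f * a0 t)) = 0"
        using a0 a1 by (simp add: lin f_def[symmetric])
      ultimately show ?thesis by (intro disjI2 exI[of _ "\<lambda>t. a1 t - f * a0 t"] conjI)
    qed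
  qed
qed

section \<open>Circuits of the boundary matrix\<close>

lemma finite_subsets_of_card: "finite (subsets_of_card n p)"
  by (rule finite_subset[of _ "Pow {1..n}"]) (auto simp: subsets_of_card_def)

lemma finite_circuit: "C \<in> circuits k n p \<Longrightarrow> finite C"
  using finite_subsets_of_card finite_subset by (auto simp: circuits_def)

text \<open>Among the relations on \<open>N\<close> whose coefficient at \<open>r\<close> is nonzero, one of minimal support has
  a circuit as its support.\<close>

lemma circuit_in_support:
  fixes c :: "nat set \<Rightarrow> 'k::field"
  assumes N: "N \<subseteq> subsets_of_card n p" and r: "c r \<noteq> 0" and supp: "\<And>s. c s \<noteq> 0 \<Longrightarrow> s \<in> N"
    and rel: "\<And>\<tau>. \<tau> \<in> subsets_of_card n (p + 1) \<Longrightarrow> (\<Sum>s\<in>N. c s * bd_matrix s \<tau>) = 0"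
  shows "\<exists>C\<in>circuits TYPE('k) n p. r \<in> C \<and> C \<subseteq> N"
proof -
  let ?T = "subsets_of_card n (p + 1)"
  define Q where "Q c \<longleftrightarrow> c r \<noteq> 0 \<and> (\<forall>s. c s \<noteq> 0 \<longrightarrow> s \<in> N) \<and> (\<forall>\<tau>\<in>?T. (\<Sum>s\<in>N. c s * bd_matrix s \<tau>) = 0)"
    for c :: "nat set \<Rightarrow> 'k"
  define supp where "supp c = {s. c s \<noteq> 0}" for c :: "nat set \<Rightarrow> 'k"
  have finN: "finite N" using N finite_subsets_of_card finite_subset by blast
  have "Q c" using assms by (auto simp: Q_def)
  then obtain c where c: "Q c" and min: "\<And>b. Q b \<Longrightarrow> card (supp c) \<le> card (supp b)"
    using ex_has_least_nat[of Q c "\<lambda>c. card (supp c)"] by auto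
  have sub: "supp c \<subseteq> N" using c by (auto simp: Q_def supp_def)
  have finc: "finite (supp c)" using sub finN finite_subset by blast
  have no: False if "Q b" "supp b \<subset> supp c" for b
    using psubset_card_mono[OF finc that(2)] min[OF that(1)] by simp
  have dep: "rows_dependent TYPE('k) n p (supp c)"
    unfolding rows_dependent_def
  proof (intro exI[of _ c] conjI ballI)
    show "\<exists>\<sigma>\<in>supp c. c \<sigma> \<noteq> 0" using c by (auto simp: Q_def supp_def)
    fix \<tau> assume t: "\<tau> \<in> ?T"
    have "(\<Sum>s\<in>supp c. c s * bd_matrix s \<tau>) = (\<Sum>s\<in>N. c s * bd_matrix s \<tau>)"
      using finN sub by (intro sum.mono_neutral_left) (auto simp: supp_def)
    then show "(\<Sum>s\<in>supp c. c s * bd_matrix s \<tau>) = 0" using c t by (auto simp: Q_def)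
  qed
  have indep: "\<not> rows_dependent TYPE('k) n p D" if D: "D \<subset> supp c" for D
  proof
    assume "rows_dependent TYPE('k) n p D"
    then obtain b0 :: "nat set \<Rightarrow> 'k" and d where d: "d \<in> D" "b0 d \<noteq> 0"
      and b0: "\<And>\<tau>. \<tau> \<in> ?T \<Longrightarrow> (\<Sum>s\<in>D. b0 s * bd_matrix s \<tau>) = 0"
      unfolding rows_dependent_def by auto
    define b where "b s = (if s \<in> D then b0 s else 0)" for s
    have b: "(\<Sum>s\<in>N. b s * bd_matrix s \<tau>) = 0" if "\<tau> \<in> ?T" for \<tau>
    proof -
      have "(\<Sum>s\<in>N. b s * bd_matrix s \<tau>) = (\<Sum>s\<in>D. b0 s * bd_matrix s \<tau>)"
        using finN sub D by (intro sum.mono_neutral_cong_right) (auto simp: b_def)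
      then show ?thesis using b0 that by simp
    qed
    show False
    proof (cases "b r = 0")
      case False
      then have "Q b" using b D sub by (auto simp: Q_def b_def)
      moreover have "supp b \<subset> supp c" using D by (auto simp: b_def supp_def)
      ultimately show False by (rule no)
    next
      case True
      \<comment> \<open>The multiple of \<open>b\<close> is chosen to cancel \<open>c\<close> at
        \<open>d\<close>. Since \<open>b r = 0\<close>, the coefficient at \<open>r\<close>
        survives, so the support shrinks without losing \<open>r\<close>.\<close>
      define e where "e s = c s - c d / b d * b s" for s
      have bd: "b d \<noteq> 0" using d by (simp add: b_def)
      have "(\<Sum>s\<in>N. e s * bd_matrix s \<tau>) =
          (\<Sum>s\<in>N. c s * bd_matrix s \<tau>) - c d / b d * (\<Sum>s\<in>N. b s * bd_matrix s \<tau>)" for \<tau>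
        by (simp add: e_def sum_subtractf sum_distrib_left left_diff_distrib mult.assoc)
      moreover have "e s \<noteq> 0 \<Longrightarrow> s \<in> supp c" for s
        using D by (auto simp: e_def b_def supp_def split: if_splits)
      ultimately have "Q e" using b c True sub by (auto simp: Q_def) (simp add: e_def)
      moreover have "supp e \<subset> supp c"
      proof
        show "supp e \<subseteq> supp c" using D by (auto simp: e_def b_def supp_def split: if_splits)
        have "d \<in> supp c - supp e" using d D bd by (auto simp: e_def supp_def)
        then show "supp e \<noteq> supp c" by auto
      qed
      ultimately show False by (rule no)
    qed
  qed
  have "supp c \<in> circuits TYPE('k) n p"
    using sub N dep indep by (auto simp: circuits_def)
  moreover have "r \<in> supp c" using c by (simp add: Q_def supp_def)
  ultimately show ?thesis using sub by blast
qed

text \<open>Links circuits to the differential: row \<sigma> of M(n,p) is nonzero only at the sets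
  \<open>insert j \<sigma>\<close>, with the signs of \<open>kdiff\<close> as entries. So M(n,p)
  applied to a column vector is a simplicial boundary.\<close>

lemma kdiff_bd_matrix:
  fixes a :: "nat set \<Rightarrow> 'k::field"
  assumes "\<sigma> \<in> subsets_of_card n p"
  shows "kdiff n (\<lambda>_. 1) a \<sigma> = (\<Sum>\<tau>\<in>subsets_of_card n (p + 1). bd_matrix \<sigma> \<tau> * a \<tau>)"
proof -
  let ?f = "\<lambda>j. insert j \<sigma>"
  have s: "\<sigma> \<subseteq> {1..n}" "card \<sigma> = p" "finite \<sigma>"
    using assms finite_subset by (auto simp: subsets_of_card_def)
  have img: "?f ` ({1..n} - \<sigma>) = {\<tau> \<in> subsets_of_card n (p + 1). \<sigma> \<subseteq> \<tau>}"
  proof (intro equalityI subsetI)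
    fix \<tau> assume "\<tau> \<in> {\<tau> \<in> subsets_of_card n (p + 1). \<sigma> \<subseteq> \<tau>}"
    then have t: "\<tau> \<subseteq> {1..n}" "card \<tau> = p + 1" "\<sigma> \<subseteq> \<tau>" by (auto simp: subsets_of_card_def)
    then have "card (\<tau> - \<sigma>) = 1" using s by (simp add: card_Diff_subset)
    then obtain j where "\<tau> - \<sigma> = {j}" by (rule card_1_singletonE)
    then show "\<tau> \<in> ?f ` ({1..n} - \<sigma>)" using t by (intro image_eqI[of _ _ j]) auto
  qed (use s in \<open>auto simp: subsets_of_card_def\<close>)
  have "(\<Sum>\<tau>\<in>subsets_of_card n (p + 1). bd_matrix \<sigma> \<tau> * a \<tau>) = (\<Sum>\<tau>\<in>?f ` ({1..n} - \<sigma>). bd_matrix \<sigma> \<tau> * a \<tau>)"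
    unfolding img using finite_subsets_of_card by (intro sum.mono_neutral_right) (auto simp: bd_matrix_def)
  also have "\<dots> = (\<Sum>j\<in>{1..n} - \<sigma>. bd_matrix \<sigma> (?f j) * a (?f j))"
    by (rule sum.reindex[unfolded o_def]) (auto simp: inj_on_def)
  also have "\<dots> = kdiff n (\<lambda>_. 1) a \<sigma>"
    unfolding kdiff_def
  proof (intro sum.cong refl)
    fix j assume "j \<in> {1..n} - \<sigma>"
    then have "insert j \<sigma> - \<sigma> = {j}" by auto
    then show "bd_matrix \<sigma> (?f j) * a (?f j) = of_int (koszul_sgn \<sigma> j) * (1 * a (?f j))"
      by (auto simp: bd_matrix_def koszul_sgn_insert_same)
  qed
  finally show ?thesis by simp
qed

section \<open>Contracting the simplex to a vertex, and the circuit criterion\<close>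

lemma wedge_sgn_empty_left [simp]: "wedge_sgn {} \<sigma> = 1"
  by (simp add: wedge_sgn_def)

text \<open>In the augmented complex the boundary of a vertex is the unit. This is the term of the
  Leibniz rule that reproduces \<open>y\<close> when \<open>y\<close> is wedged with e_v.\<close>

lemma kmult_kdiff_single:
  assumes "finite \<sigma>" "v \<in> {1..n}"
  shows "kmult (kdiff n (\<lambda>_. 1) (\<lambda>\<tau>. if \<tau> = {v} then 1 else 0)) y \<sigma> = y \<sigma>"
proof -
  have k: "kdiff n (\<lambda>_. 1) (\<lambda>\<tau>. if \<tau> = {v} then 1 else 0) \<tau> = (if \<tau> = {} then 1 else (0::'a))" for \<tau>
  proof (cases "\<tau> = {}")
    case True
    have "kdiff n (\<lambda>_. 1) (\<lambda>\<tau>. if \<tau> = {v} then 1 else 0) {} = (\<Sum>j\<in>{1..n}. if j = v then 1 else (0::'a))"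
      unfolding kdiff_def by (intro sum.cong) (auto simp: koszul_sgn_def)
    then show ?thesis using True assms(2) by simp
  next
    case False
    have "(if insert j \<tau> = {v} then 1 else 0) = (0::'a)" if "j \<in> {1..n} - \<tau>" for j
      using False that by auto
    then show ?thesis unfolding kdiff_def using False by (simp only: mult_zero_right sum.neutral_const if_False cong: sum.cong)
  qed
  have "kmult (kdiff n (\<lambda>_. 1) (\<lambda>\<tau>. if \<tau> = {v} then 1 else 0)) y \<sigma> =
      (\<Sum>\<tau>\<in>Pow \<sigma>. if \<tau> = {} then y \<sigma> else 0)"
    unfolding kmult_def k by (intro sum.cong refl) auto
  then show ?thesis using assms(1) by simp
qed

text \<open>The wedge product with \<open>e\<^sub>v\<close> is a contracting homotopy of the simplicial complex, and it
  preserves chains supported on \<open>Pow A\<close> when \<open>v \<in> A\<close>. This replaces an arbitrary solution of the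
  boundary equation by one supported on \<open>Pow A\<close>.\<close>

lemma boundary_solution_iff_circuits:
  fixes G :: "nat set \<Rightarrow> bool"
  assumes \<rho>: "\<rho> \<subseteq> A" "\<rho> \<noteq> {}" and A: "A \<subseteq> {1..n}" and G: "\<And>\<sigma>. \<sigma> \<subseteq> {1..n} \<Longrightarrow> G \<sigma> \<Longrightarrow> \<sigma> \<subseteq> A"
  shows "(\<exists>a :: nat set \<Rightarrow> 'k::field. (\<forall>\<sigma>. a \<sigma> \<noteq> 0 \<longrightarrow> \<sigma> \<subseteq> A) \<and>
      (\<forall>\<sigma>. \<sigma> \<subseteq> {1..n} \<and> kdiff n (\<lambda>_. 1) a \<sigma> \<noteq> (if \<sigma> = \<rho> then 1 else 0) \<longrightarrow> G \<sigma>))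
    \<longleftrightarrow> (if \<rho> = {1..n} then G \<rho> else \<forall>C\<in>circuits TYPE('k) n (card \<rho>). \<rho> \<in> C \<longrightarrow> (\<exists>\<sigma>\<in>C. G \<sigma>))"
    (is "?L \<longleftrightarrow> ?R")
proof
  assume ?L
  then obtain a :: "nat set \<Rightarrow> 'k" where
    "\<forall>\<sigma>. \<sigma> \<subseteq> {1..n} \<and> kdiff n (\<lambda>_. 1) a \<sigma> \<noteq> (if \<sigma> = \<rho> then 1 else 0) \<longrightarrow> G \<sigma>"
    by (elim exE conjE)
  then have a: "\<And>\<sigma>. \<sigma> \<subseteq> {1..n} \<Longrightarrow> kdiff n (\<lambda>_. 1) a \<sigma> \<noteq> (if \<sigma> = \<rho> then 1 else 0) \<Longrightarrow> G \<sigma>"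
    by (metis (no_types))
  show ?R
  proof (cases "\<rho> = {1..n}")
    case True
    \<comment> \<open>At the full set every boundary is an empty sum, so it cannot agree with
      e_\<rho> there.\<close>
    have "G {1..n}" by (rule a) (auto simp: True kdiff_def)
    then show ?thesis using True by simp
  next
    case False
    have "\<exists>\<sigma>\<in>C. G \<sigma>" if C: "C \<in> circuits TYPE('k) n (card \<rho>)" and rC: "\<rho> \<in> C" for C
    proof (rule ccontr)
      assume no: "\<not> (\<exists>\<sigma>\<in>C. G \<sigma>)"
      let ?T = "subsets_of_card n (card \<rho> + 1)"
      have finC: "finite C" using finite_circuit[OF C] .
      have "rows_dependent TYPE('k) n (card \<rho>) C" using C by (simp add: circuits_def)
      then obtain b0 :: "nat set \<Rightarrow> 'k" where b0: "\<exists>s\<in>C. b0 s \<noteq> 0"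
        "\<forall>\<tau>\<in>?T. (\<Sum>s\<in>C. b0 s * bd_matrix s \<tau>) = 0"
        unfolding rows_dependent_def by (elim exE conjE)
      \<comment> \<open>By minimality each row of a circuit has a nonzero coefficient in its
        relation.\<close>
      have br: "b0 \<rho> \<noteq> 0"
      proof
        assume z: "b0 \<rho> = 0"
        have "rows_dependent TYPE('k) n (card \<rho>) (C - {\<rho>})"
          unfolding rows_dependent_def
        proof (intro exI[of _ b0] conjI ballI)
          show "\<exists>\<sigma>\<in>C - {\<rho>}. b0 \<sigma> \<noteq> 0" using b0(1) z by auto
          show "(\<Sum>s\<in>C - {\<rho>}. b0 s * bd_matrix s \<tau>) = 0" if "\<tau> \<in> ?T" for \<tau>
            using b0(2)[rule_format, OF that] z finC rC by (simp add: sum.remove[of C \<rho>])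
        qed
        moreover have "C - {\<rho>} \<subset> C" using rC by auto
        ultimately show False using C by (auto simp: circuits_def)
      qed
      \<comment> \<open>The relation paired with the boundary of \<open>a\<close> gives 0. If no
        face of \<open>C\<close> is killed, that boundary agrees with e_\<rho> on \<open>C\<close>,
        and the pairing is \<open>b0 \<rho>\<close> instead.\<close>
      have "(\<Sum>s\<in>C. b0 s * kdiff n (\<lambda>_. 1) a s) = (\<Sum>s\<in>C. \<Sum>\<tau>\<in>?T. b0 s * bd_matrix s \<tau> * a \<tau>)"
      proof (intro sum.cong refl)
        fix s assume "s \<in> C"
        then have "s \<in> subsets_of_card n (card \<rho>)" using C by (auto simp: circuits_def)
        then show "b0 s * kdiff n (\<lambda>_. 1) a s = (\<Sum>\<tau>\<in>?T. b0 s * bd_matrix s \<tau> * a \<tau>)"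
          by (simp only: kdiff_bd_matrix sum_distrib_left mult.assoc)
      qed
      also have "\<dots> = (\<Sum>\<tau>\<in>?T. (\<Sum>s\<in>C. b0 s * bd_matrix s \<tau>) * a \<tau>)"
        by (subst sum.swap) (simp add: sum_distrib_right)
      also have "\<dots> = 0" by (rule sum.neutral) (use b0(2) in force)
      finally have "(\<Sum>s\<in>C. b0 s * kdiff n (\<lambda>_. 1) a s) = 0" .
      moreover have "(\<Sum>s\<in>C. b0 s * kdiff n (\<lambda>_. 1) a s) = (\<Sum>s\<in>C. if s = \<rho> then b0 s else 0)"
      proof (intro sum.cong refl)
        fix s assume "s \<in> C"
        then have "s \<subseteq> {1..n}" "\<not> G s" using C no by (auto simp: circuits_def subsets_of_card_def)
        then have "kdiff n (\<lambda>_. 1) a s = (if s = \<rho> then 1 else 0)" using a by blast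
        then show "b0 s * kdiff n (\<lambda>_. 1) a s = (if s = \<rho> then b0 s else 0)" by simp
      qed
      ultimately show False using finC rC br by simp
    qed
    then show ?thesis using False by simp
  qed
next
  assume R: ?R
  have rn: "\<rho> \<subseteq> {1..n}" using \<rho> A by auto
  show ?L
  proof (cases "G \<rho>")
    case True
    \<comment> \<open>The zero chain fails only at \<rho>, which is killed.\<close>
    then show ?thesis by (intro exI[of _ "\<lambda>_. 0"]) (auto simp: kdiff_def)
  next
    case nG: False
    then have ne: "\<rho> \<noteq> {1..n}" using R by auto
    define p where "p = card \<rho>"
    let ?T = "subsets_of_card n (p + 1)"
    define N where "N = {s \<in> subsets_of_card n p. \<not> G s}"
    have finN: "finite N" using finite_subsets_of_card by (simp add: N_def)
    have rN: "\<rho> \<in> N" using rn nG by (auto simp: N_def subsets_of_card_def p_def)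
    \<comment> \<open>Otherwise the rows in \<open>N\<close> carry a relation through \<rho>, hence
      a circuit through \<rho> without killed faces, contrary to the hypothesis.\<close>
    have "\<not> (\<exists>c. \<forall>\<tau>\<in>?T. bd_matrix \<rho> \<tau> = (\<Sum>s\<in>N - {\<rho>}. (c s :: 'k) * bd_matrix s \<tau>))"
    proof
      assume "\<exists>c. \<forall>\<tau>\<in>?T. bd_matrix \<rho> \<tau> = (\<Sum>s\<in>N - {\<rho>}. (c s :: 'k) * bd_matrix s \<tau>)"
      then obtain c :: "nat set \<Rightarrow> 'k" where c: "\<And>\<tau>. \<tau> \<in> ?T \<Longrightarrow> bd_matrix \<rho> \<tau> = (\<Sum>s\<in>N - {\<rho>}. c s * bd_matrix s \<tau>)" by auto
      define c' where "c' s = (if s = \<rho> then -1 else if s \<in> N then c s else 0)" for s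
      have "\<exists>C\<in>circuits TYPE('k) n p. \<rho> \<in> C \<and> C \<subseteq> N"
      proof (rule circuit_in_support[of _ _ _ c'])
        fix \<tau> assume t: "\<tau> \<in> ?T"
        have "(\<Sum>s\<in>N. c' s * bd_matrix s \<tau>) = - bd_matrix \<rho> \<tau> + (\<Sum>s\<in>N - {\<rho>}. c s * bd_matrix s \<tau>)"
          using finN rN by (simp add: sum.remove[of N \<rho>] c'_def)
        then show "(\<Sum>s\<in>N. c' s * bd_matrix s \<tau>) = 0" using c[OF t] by simp
      qed (use rN in \<open>auto simp: N_def c'_def split: if_splits\<close>)
      then show False using R ne by (auto simp: p_def N_def)
    qed
    then obtain a0 :: "nat set \<Rightarrow> 'k" where a0: "\<forall>s\<in>N - {\<rho>}. (\<Sum>\<tau>\<in>?T. bd_matrix s \<tau> * a0 \<tau>) = 0"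
      "(\<Sum>\<tau>\<in>?T. bd_matrix \<rho> \<tau> * a0 \<tau>) = 1"
      using span_or_separate[where D = "N - {\<rho>}" and T = ?T and v = "bd_matrix \<rho>" and M = bd_matrix,
          OF finite_Diff[OF finN] finite_subsets_of_card]
      by (elim disjE) (erule (1) notE, elim exE conjE)
    \<comment> \<open>Only the values on sets of size \<open>p + 1\<close> enter the equations.
      Cutting off the others makes the boundary \<open>y\<close> vanish outside the sets of size
      \<open>p\<close>.\<close>
    define a where "a \<tau> = (if \<tau> \<in> ?T then a0 \<tau> else 0)" for \<tau>
    define y where "y = kdiff n (\<lambda>_. 1) a"
    have yN: "y s = (if s = \<rho> then 1 else 0)" if "s \<in> N" for s
    proof -
      have "s \<in> subsets_of_card n p" using that by (simp add: N_def)
      from kdiff_bd_matrix[OF this, of a] show ?thesis using that a0 by (auto simp: y_def a_def)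
    qed
    have ysupp: "s \<in> subsets_of_card n p" if y: "y s \<noteq> 0" for s
    proof -
      obtain j where j: "j \<in> {1..n} - s" "a (insert j s) \<noteq> 0"
        using y unfolding y_def kdiff_def by (metis (no_types, lifting) mult_zero_right sum.neutral)
      then have "insert j s \<in> ?T" by (auto simp: a_def split: if_splits)
      then have "insert j s \<subseteq> {1..n}" "card (insert j s) = p + 1" by (auto simp: subsets_of_card_def)
      moreover from this have "finite s" using finite_subset by auto
      ultimately show ?thesis using j by (auto simp: subsets_of_card_def)
    qed
    \<comment> \<open>A face where \<open>y\<close> is nonzero is either killed, hence contained in
      \<open>A\<close> by the assumption on \<open>G\<close>, or equal to \<rho>.\<close>
    have yA: "s \<subseteq> A" if "y s \<noteq> 0" for s
    proof (cases "G s")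
      case False
      then have "s \<in> N" using ysupp[OF that] by (simp add: N_def)
      then show ?thesis using yN that \<rho>(1) by (auto split: if_splits)
    qed (use G ysupp[OF that] in \<open>simp add: subsets_of_card_def\<close>)
    obtain v where v: "v \<in> \<rho>" using \<rho> by auto
    define Z where "Z = (\<lambda>\<tau>. if \<tau> = {v} then 1 else (0::'k))"
    \<comment> \<open>The wedge product of e_v with \<open>y\<close> fills \<open>y\<close> inside
      \<open>A\<close>. Since \<open>y\<close> is itself a boundary, the other term of the Leibniz
      rule vanishes.\<close>
    define a' where "a' = kmult Z y"
    have "a' \<sigma> \<noteq> 0 \<Longrightarrow> \<sigma> \<subseteq> A" for \<sigma>
    proof -
      assume "a' \<sigma> \<noteq> 0"
      then obtain \<tau> where "\<tau> \<in> Pow \<sigma>" "Z \<tau> \<noteq> 0" "y (\<sigma> - \<tau>) \<noteq> 0"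
        unfolding a'_def kmult_def by (metis (no_types, lifting) mult_zero_left mult_zero_right sum.neutral)
      then show "\<sigma> \<subseteq> A" using yA v \<rho>(1) by (auto simp: Z_def split: if_splits)
    qed
    moreover have "kdiff n (\<lambda>_. 1) a' \<sigma> = y \<sigma>" if s: "\<sigma> \<subseteq> {1..n}" for \<sigma>
    proof -
      have fin: "finite \<sigma>" using s finite_subset by blast
      have "kmult (\<lambda>\<sigma>. (-1) ^ card \<sigma> * Z \<sigma>) (kdiff n (\<lambda>_. 1) y) \<sigma> = 0"
        unfolding kmult_def y_def using fin by (intro sum.neutral) (auto simp: kdiff_kdiff)
      moreover have "v \<in> {1..n}" using v rn by auto
      ultimately show ?thesis
        unfolding a'_def kdiff_kmult[OF s] using kmult_kdiff_single[OF fin, of v n y]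
        by (simp add: Z_def)
    qed
    moreover have "G \<sigma>" if "\<sigma> \<subseteq> {1..n}" "y \<sigma> \<noteq> (if \<sigma> = \<rho> then 1 else 0)" for \<sigma>
    proof -
      have "\<sigma> \<in> subsets_of_card n p"
        using that ysupp[of \<sigma>] rN by (auto simp: N_def split: if_splits)
      then show ?thesis using yN that by (auto simp: N_def)
    qed
    ultimately show ?thesis by (intro exI[of _ a'] conjI allI impI) (assumption | metis (no_types, lifting))+
  qed
qed


section \<open>Monomial ideals as spans of sets of monomials\<close>

definition exponents :: "nat \<Rightarrow> (nat \<Rightarrow>\<^sub>0 nat) set" where
  "exponents n = {m. Poly_Mapping.keys m \<subseteq> {1..n}}"

definition monomial_span :: "(nat \<Rightarrow>\<^sub>0 nat) set \<Rightarrow> 'k::field mpoly set" where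
  "monomial_span U = {f. Poly_Mapping.keys f \<subseteq> U}"

text \<open>The exponent sets of monomial ideals. With them, sums, products and colons of ideals
  become statements about sets of exponents.\<close>

definition up_closed :: "nat \<Rightarrow> (nat \<Rightarrow>\<^sub>0 nat) set \<Rightarrow> bool" where
  "up_closed n U \<longleftrightarrow> U \<subseteq> exponents n \<and> (\<forall>m\<in>U. \<forall>k\<in>exponents n. m + k \<in> U)"

definition indicator_exp :: "nat set \<Rightarrow> (nat \<Rightarrow>\<^sub>0 nat)" where
  "indicator_exp A = (\<Sum>i\<in>A. Poly_Mapping.single i 1)"

section \<open>Arithmetic of exponents and of monomial spans\<close>

lemma keys_add_nat: "Poly_Mapping.keys (a + b :: nat \<Rightarrow>\<^sub>0 nat) = Poly_Mapping.keys a \<union> Poly_Mapping.keys b"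
  by (auto simp: in_keys_iff lookup_add)

lemma lookup_indicator_exp:
  "finite A \<Longrightarrow> Poly_Mapping.lookup (indicator_exp A) i = (if i \<in> A then 1 else 0)"
  by (simp add: indicator_exp_def lookup_sum lookup_single when_def)

lemma indicator_exp_Un:
  "finite A \<Longrightarrow> finite B \<Longrightarrow> A \<inter> B = {} \<Longrightarrow> indicator_exp (A \<union> B) = indicator_exp A + indicator_exp B"
  by (simp add: indicator_exp_def sum.union_disjoint)

lemma indicator_exp_insert:
  "finite A \<Longrightarrow> j \<notin> A \<Longrightarrow> indicator_exp (insert j A) = Poly_Mapping.single j 1 + indicator_exp A"
  by (simp add: indicator_exp_def)

lemma keys_indicator_exp: "finite A \<Longrightarrow> Poly_Mapping.keys (indicator_exp A) = A"
  by (auto simp: in_keys_iff lookup_indicator_exp split: if_splits)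

lemma exponents_add: "a + b \<in> exponents n \<longleftrightarrow> a \<in> exponents n \<and> b \<in> exponents n"
  by (auto simp: exponents_def keys_add_nat)

lemma exponents_single: "j \<in> {1..n} \<Longrightarrow> Poly_Mapping.single j c \<in> exponents n"
  by (auto simp: exponents_def)

lemma exponents_zero [simp]: "0 \<in> exponents n"
  by (simp add: exponents_def)

lemma exponents_indicator: "A \<subseteq> {1..n} \<Longrightarrow> indicator_exp A \<in> exponents n"
  using finite_subset[of A "{1..n}"] by (simp add: exponents_def keys_indicator_exp)

lemma exponents_single_iff: "Poly_Mapping.single j 1 \<in> exponents n \<longleftrightarrow> j \<in> {1..n}"
  by (simp add: exponents_def)

lemma mem_monomial_span: "f \<in> monomial_span U \<longleftrightarrow> (\<forall>m. Poly_Mapping.lookup f m \<noteq> 0 \<longrightarrow> m \<in> U)"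
  by (auto simp: monomial_span_def in_keys_iff)

lemma monomial_span_zero [simp]: "0 \<in> monomial_span U"
  by (simp add: mem_monomial_span)

lemma monomial_span_add: "f \<in> monomial_span U \<Longrightarrow> g \<in> monomial_span U \<Longrightarrow> f + g \<in> monomial_span U"
  unfolding mem_monomial_span lookup_add by (metis add.right_neutral)

lemma monomial_span_uminus: "f \<in> monomial_span U \<Longrightarrow> - f \<in> monomial_span U"
  by (auto simp: mem_monomial_span)

lemma monomial_span_diff: "f \<in> monomial_span U \<Longrightarrow> g \<in> monomial_span U \<Longrightarrow> f - g \<in> monomial_span U"
  using monomial_span_add[OF _ monomial_span_uminus, of f U g] by simp

lemma monomial_span_sum: "(\<And>i. i \<in> A \<Longrightarrow> f i \<in> monomial_span U) \<Longrightarrow> sum f A \<in> monomial_span U"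
  by (induction A rule: infinite_finite_induct) (auto intro: monomial_span_add)

lemma monomial_span_single: "Poly_Mapping.single m c \<in> monomial_span U \<longleftrightarrow> c = 0 \<or> m \<in> U"
  by (auto simp: mem_monomial_span lookup_single when_def)

lemma monomial_span_mult:
  "f \<in> monomial_span U \<Longrightarrow> g \<in> monomial_span V \<Longrightarrow> (\<And>a b. a \<in> U \<Longrightarrow> b \<in> V \<Longrightarrow> a + b \<in> W) \<Longrightarrow>
    f * g \<in> monomial_span W"
  using keys_mult[of f g] by (fastforce simp: monomial_span_def)

lemma monomial_span_mono: "U \<subseteq> V \<Longrightarrow> monomial_span U \<subseteq> monomial_span V"
  by (auto simp: monomial_span_def)

lemma up_closed_exponents: "up_closed n (exponents n)"
  by (simp add: up_closed_def exponents_add)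

lemma monomial_span_mult_right:
  assumes "up_closed n U" "f \<in> monomial_span U" "g \<in> monomial_span (exponents n)"
  shows "f * g \<in> monomial_span U" "g * f \<in> monomial_span U"
proof -
  show "f * g \<in> monomial_span U"
    using assms(2,3) by (rule monomial_span_mult) (use assms(1) in \<open>auto simp: up_closed_def\<close>)
  then show "g * f \<in> monomial_span U" by (simp add: mult.commute)
qed

lemma lookup_sign_mult:
  "s = 1 \<or> s = -1 \<Longrightarrow> Poly_Mapping.lookup (of_int s * f) m = of_int s * Poly_Mapping.lookup f m"
  for f :: "'k::field mpoly"
  by auto

lemma monomial_span_sign:
  "s = 1 \<or> s = -1 \<Longrightarrow> f \<in> monomial_span U \<Longrightarrow> of_int s * f \<in> monomial_span U"
  by (auto intro: monomial_span_uminus)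

lemma sum_monomials: "(\<Sum>m\<in>Poly_Mapping.keys f. Poly_Mapping.single m (Poly_Mapping.lookup f m)) = f"
  by (rule poly_mapping_eqI) (simp add: lookup_sum lookup_single when_def in_keys_iff)

lemma single_mult_eq_sum:
  "Poly_Mapping.single t c * f = (\<Sum>m\<in>Poly_Mapping.keys f. Poly_Mapping.single (t + m) (c * Poly_Mapping.lookup f m))"
  for f :: "'k::field mpoly"
proof -
  have "Poly_Mapping.single t c * f =
      Poly_Mapping.single t c * (\<Sum>m\<in>Poly_Mapping.keys f. Poly_Mapping.single m (Poly_Mapping.lookup f m))"
    by (simp only: sum_monomials)
  then show ?thesis by (simp add: sum_distrib_left mult_single)
qed

lemma lookup_single_mult:
  "Poly_Mapping.lookup (Poly_Mapping.single t c * f) (t + m) = c * Poly_Mapping.lookup f m"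
  for f :: "'k::field mpoly"
  unfolding single_mult_eq_sum by (simp add: lookup_sum lookup_single when_def in_keys_iff)

lemma lookup_single_mult_eq_0:
  fixes f :: "'k::field mpoly"
  assumes "\<And>m'. m \<noteq> t + m'"
  shows "Poly_Mapping.lookup (Poly_Mapping.single t c * f) m = 0"
proof -
  have "t + k \<noteq> m" for k using assms by metis
  then show ?thesis unfolding single_mult_eq_sum by (simp add: lookup_sum lookup_single when_def)
qed

lemma single_mult_mem_monomial_span:
  "Poly_Mapping.single t 1 * f \<in> monomial_span U \<longleftrightarrow> f \<in> monomial_span {m. t + m \<in> U}"
  by (simp add: mem_monomial_span)
    (metis lookup_single_mult lookup_single_mult_eq_0 mult_1)

lemma image_single_mult:
  "(\<lambda>f. Poly_Mapping.single t 1 * f) ` monomial_span W = (monomial_span ((\<lambda>m. t + m) ` W) :: 'k::field mpoly set)"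
proof (intro equalityI subsetI)
  fix f :: "'k mpoly" assume "f \<in> monomial_span ((\<lambda>m. t + m) ` W)"
  then have f: "\<exists>w\<in>W. m = t + w" if "m \<in> Poly_Mapping.keys f" for m
    using that by (auto simp: monomial_span_def)
  \<comment> \<open>Every term of \<open>f\<close> is divided by x^t; the subtraction is exact
    because each exponent in \<open>f\<close> has the form \<open>t + w\<close>.\<close>
  define g where "g = (\<Sum>m\<in>Poly_Mapping.keys f. Poly_Mapping.single (m - t) (Poly_Mapping.lookup f m))"
  have "g \<in> monomial_span W"
    unfolding g_def using f by (intro monomial_span_sum) (fastforce simp: monomial_span_single)
  moreover have "Poly_Mapping.single t 1 * g = (\<Sum>m\<in>Poly_Mapping.keys f. Poly_Mapping.single m (Poly_Mapping.lookup f m))"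
    unfolding g_def sum_distrib_left mult_single using f by (intro sum.cong refl) fastforce
  ultimately show "f \<in> (\<lambda>f. Poly_Mapping.single t 1 * f) ` monomial_span W"
    by (auto simp: sum_monomials intro!: image_eqI[of _ _ g])
next
  fix f :: "'k mpoly" assume "f \<in> (\<lambda>f. Poly_Mapping.single t 1 * f) ` monomial_span W"
  then obtain g where g: "f = Poly_Mapping.single t 1 * g" "g \<in> monomial_span W" by auto
  have "Poly_Mapping.single t (1::'k) \<in> monomial_span {t}" by (simp add: monomial_span_single)
  from monomial_span_mult[OF this g(2)] show "f \<in> monomial_span ((\<lambda>m. t + m) ` W)" unfolding g(1) by blast
qed


section \<open>The polynomial ring\<close>

lemma poly_ring_simps [simp]:
  "carrier (poly_ring n) = monomial_span (exponents n)"
  "mult (poly_ring n) = (*)" "one (poly_ring n) = 1" "zero (poly_ring n) = 0" "add (poly_ring n) = (+)"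
  by (auto simp: poly_ring_def monomial_span_def exponents_def)

lemma cring_poly_ring: "cring (poly_ring n :: 'k::field mpoly ring)"
proof (rule cringI)
  show "abelian_group (poly_ring n :: 'k mpoly ring)"
  proof (rule abelian_groupI)
    fix x :: "'k mpoly" assume "x \<in> carrier (poly_ring n)"
    then show "\<exists>y\<in>carrier (poly_ring n). y \<oplus>\<^bsub>poly_ring n\<^esub> x = \<zero>\<^bsub>poly_ring n\<^esub>"
      by (intro bexI[of _ "- x"]) (auto intro: monomial_span_uminus)
  qed (auto intro: monomial_span_add simp: add_ac)
  show "Group.comm_monoid (poly_ring n :: 'k mpoly ring)"
  proof (rule comm_monoidI)
    show "\<one>\<^bsub>poly_ring n\<^esub> \<in> carrier (poly_ring n :: 'k mpoly ring)"
      by (simp add: monomial_span_def)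
  qed (auto simp: mult_ac intro: monomial_span_mult_right(1)[OF up_closed_exponents])
qed (simp add: distrib_right)

lemma ring_poly_ring: "ring (poly_ring n)"
  using cring_poly_ring cring.axioms(1) by blast

lemma poly_ring_a_inv:
  assumes "f \<in> monomial_span (exponents n)"
  shows "\<ominus>\<^bsub>poly_ring n\<^esub> f = - f"
proof -
  interpret ring "poly_ring n" by (rule ring_poly_ring)
  show ?thesis by (rule minus_equality) (use assms in \<open>auto intro: monomial_span_uminus\<close>)
qed

lemma poly_ring_finsum:
  assumes "\<And>i. i \<in> A \<Longrightarrow> f i \<in> monomial_span (exponents n)"
  shows "(\<Oplus>\<^bsub>poly_ring n\<^esub>i\<in>A. f i) = sum f A"
proof -
  interpret ring "poly_ring n" by (rule ring_poly_ring)
  show ?thesis using assms by (induction A rule: infinite_finite_induct) auto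
qed

lemma ideal_monomial_span:
  assumes "up_closed n U"
  shows "ideal (monomial_span U) (poly_ring n :: 'k::field mpoly ring)"
proof -
  interpret ring "poly_ring n :: 'k mpoly ring" by (rule ring_poly_ring)
  have sub: "monomial_span U \<subseteq> (monomial_span (exponents n) :: 'k mpoly set)"
    using assms by (intro monomial_span_mono) (simp add: up_closed_def)
  show ?thesis
  proof (rule idealI)
    show "subgroup (monomial_span U) (add_monoid (poly_ring n :: 'k mpoly ring))"
    proof (rule add.subgroupI)
      show "monomial_span U \<noteq> ({} :: 'k mpoly set)" using monomial_span_zero by blast
    next
      fix a :: "'k mpoly" assume a: "a \<in> monomial_span U"
      then have "\<ominus>\<^bsub>poly_ring n\<^esub> a = - a"
        using sub by (intro poly_ring_a_inv) auto
      then show "\<ominus>\<^bsub>poly_ring n\<^esub> a \<in> monomial_span U"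
        using a by (simp only: monomial_span_uminus)
    qed (use sub in \<open>auto intro: monomial_span_add\<close>)
  qed (use assms ring_axioms in \<open>auto intro: monomial_span_mult_right\<close>)
qed

lemma up_closed_generated:
  assumes "E \<subseteq> exponents n"
  shows "up_closed n {m + k | m k. m \<in> E \<and> k \<in> exponents n}"
proof -
  have "\<exists>a b. m + k + l = a + b \<and> a \<in> E \<and> b \<in> exponents n"
    if "m \<in> E" "k \<in> exponents n" "l \<in> exponents n" for m k l
    using that by (intro exI[of _ m] exI[of _ "k + l"]) (simp add: add.assoc exponents_add)
  then show ?thesis using assms by (auto simp: up_closed_def exponents_add)
qed

lemma genideal_monomials:
  assumes "E \<subseteq> exponents n"
  shows "Idl\<^bsub>poly_ring n\<^esub> ((\<lambda>m. Poly_Mapping.single m 1) ` E) =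
    (monomial_span {m + k | m k. m \<in> E \<and> k \<in> exponents n} :: 'k::field mpoly set)"
    (is "Idl\<^bsub>_\<^esub> ?M = monomial_span ?U")
proof -
  interpret ring "poly_ring n :: 'k mpoly ring" by (rule ring_poly_ring)
  have up: "up_closed n ?U"
    using assms by (rule up_closed_generated)
  have Ms: "?M \<subseteq> monomial_span ?U"
  proof
    fix f :: "'k mpoly" assume "f \<in> ?M"
    then obtain m where "f = Poly_Mapping.single m 1" "m \<in> E" by auto
    moreover have "m \<in> ?U" if "m \<in> E" for m
      using that by (intro CollectI exI[of _ m] exI[of _ 0]) simp
    ultimately show "f \<in> monomial_span ?U" by (simp add: monomial_span_single)
  qed
  moreover have Mc: "?M \<subseteq> carrier (poly_ring n :: 'k mpoly ring)"
    using assms by (auto simp: monomial_span_single)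
  moreover have "f \<in> Idl\<^bsub>poly_ring n\<^esub> ?M" if "f \<in> monomial_span ?U" for f :: "'k mpoly"
  proof -
    interpret J: ideal "Idl\<^bsub>poly_ring n\<^esub> ?M" "poly_ring n :: 'k mpoly ring"
      by (rule genideal_ideal[OF Mc])
    have gen: "?M \<subseteq> Idl\<^bsub>poly_ring n\<^esub> ?M" by (rule genideal_self[OF Mc])
    \<comment> \<open>Each term of \<open>f\<close> is a multiple of a generator, so partial sums
      over subsets of the support stay in the ideal; the whole support gives
      \<open>f\<close>.\<close>
    have "(\<Sum>m\<in>K. Poly_Mapping.single m (Poly_Mapping.lookup f m)) \<in> Idl\<^bsub>poly_ring n\<^esub> ?M"
      if "finite K" "K \<subseteq> Poly_Mapping.keys f" for K
      using that
    proof (induction K rule: finite_induct)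
      case empty
      then show ?case using J.zero_closed by simp
    next
      case (insert m K)
      from insert.prems \<open>f \<in> monomial_span ?U\<close> obtain a b where m: "m = a + b" "a \<in> E" "b \<in> exponents n"
        by (auto simp: monomial_span_def)
      have "Poly_Mapping.single a 1 \<otimes>\<^bsub>poly_ring n\<^esub> Poly_Mapping.single b (Poly_Mapping.lookup f m) \<in> Idl\<^bsub>poly_ring n\<^esub> ?M"
        using gen m by (intro J.I_r_closed) (auto simp: monomial_span_single)
      then have "Poly_Mapping.single m (Poly_Mapping.lookup f m) \<in> Idl\<^bsub>poly_ring n\<^esub> ?M"
        by (simp add: mult_single m)
      then show ?case using insert J.a_closed by fastforce
    qed
    from this[of "Poly_Mapping.keys f"] show ?thesis by (simp add: sum_monomials)
  qed
  ultimately show ?thesis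
    using genideal_minimal[OF ideal_monomial_span[OF up] Ms] by blast
qed

lemma monomial_ideal_eq_monomial_span:
  assumes "monomial_ideal n (I :: 'k::field mpoly set)"
  obtains U where "up_closed n U" "I = monomial_span U"
proof -
  from assms obtain M where M: "M \<subseteq> monomials n" "I = Idl\<^bsub>poly_ring n\<^esub> M"
    by (auto simp: monomial_ideal_def)
  define E where "E = {m. Poly_Mapping.single m (1::'k) \<in> M \<and> m \<in> exponents n}"
  have "M = (\<lambda>m. Poly_Mapping.single m 1) ` E"
    using M(1) by (fastforce simp: monomials_def E_def exponents_def)
  moreover have E: "E \<subseteq> exponents n" by (auto simp: E_def)
  ultimately have "I = monomial_span {m + k | m k. m \<in> E \<and> k \<in> exponents n}"
    unfolding M(2) by (simp only: genideal_monomials)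
  moreover have "up_closed n {m + k | m k. m \<in> E \<and> k \<in> exponents n}"
    using E by (rule up_closed_generated)
  ultimately show thesis by (rule that[rotated])
qed

text \<open>Testing against the variables suffices, and each monomial can be tested alone. The
  resulting condition is the one under which a monomial times e_A is a cycle.\<close>

lemma colon_var_ideal:
  assumes U: "up_closed n U" and A: "A \<subseteq> {1..n}"
  shows "colon (poly_ring n) (monomial_span U) (var_ideal n A) =
    (monomial_span {m \<in> exponents n. \<forall>j\<in>A. m + Poly_Mapping.single j 1 \<in> U} :: 'k::field mpoly set)"
    (is "_ = monomial_span ?V")
proof -
  let ?x = "\<lambda>j. Poly_Mapping.single j (1::nat)"
  have e: "?x ` A \<subseteq> exponents n" using A by (auto intro!: exponents_single)
  have Var: "Var ` A = (\<lambda>m. Poly_Mapping.single m (1::'k)) ` ?x ` A"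
    by (simp add: Var_def image_image)
  have v: "var_ideal n A = (monomial_span {m + k | m k. m \<in> ?x ` A \<and> k \<in> exponents n} :: 'k mpoly set)"
    unfolding var_ideal_def Var by (rule genideal_monomials[OF e])
  show ?thesis
  proof (intro equalityI subsetI)
    fix f :: "'k mpoly" assume f: "f \<in> colon (poly_ring n) (monomial_span U) (var_ideal n A)"
    then have fe: "f \<in> monomial_span (exponents n)" by (simp add: colon_def)
    have "f \<in> monomial_span {m. ?x j + m \<in> U}" if "j \<in> A" for j
    proof -
      have "?x j + 0 \<in> {m + k | m k. m \<in> ?x ` A \<and> k \<in> exponents n}"
        using that exponents_zero by blast
      then have "Poly_Mapping.single (?x j) 1 \<in> (var_ideal n A :: 'k mpoly set)"
        unfolding v monomial_span_single by simp
      then have "Poly_Mapping.single (?x j) 1 * f \<in> monomial_span U"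
        using f by (auto simp: colon_def mult.commute)
      then show ?thesis by (simp only: single_mult_mem_monomial_span)
    qed
    then show "f \<in> monomial_span ?V" using fe by (auto simp: monomial_span_def add.commute)
  next
    fix f :: "'k mpoly" assume f: "f \<in> monomial_span ?V"
    have "f * g \<in> monomial_span U" if "g \<in> var_ideal n A" for g
      using f that unfolding v
      by (rule monomial_span_mult) (use U in \<open>auto simp: up_closed_def add.assoc[symmetric]\<close>)
    moreover have "f \<in> monomial_span (exponents n)" using f by (auto simp: monomial_span_def)
    ultimately show "f \<in> colon (poly_ring n) (monomial_span U) (var_ideal n A)"
      by (simp add: colon_def)
  qed
qed

text \<open>Reduces the containment in the criterion to monomials: their products lie in the product
  ideal, and spans are closed under the sums that generate it.\<close>

lemma ideal_prod_monomial_span_subset: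
  "monomial_span U \<cdot>\<^bsub>poly_ring n\<^esub> monomial_span V \<subseteq> (monomial_span W :: 'k::field mpoly set) \<longleftrightarrow>
    (\<forall>a\<in>U. \<forall>b\<in>V. a + b \<in> W)"
proof (intro iffI ballI subsetI)
  fix a b assume "monomial_span U \<cdot>\<^bsub>poly_ring n\<^esub> monomial_span V \<subseteq> (monomial_span W :: 'k mpoly set)"
    and "a \<in> U" "b \<in> V"
  moreover from this have "Poly_Mapping.single a 1 \<otimes>\<^bsub>poly_ring n\<^esub> Poly_Mapping.single b (1::'k) \<in>
      monomial_span U \<cdot>\<^bsub>poly_ring n\<^esub> monomial_span V"
    by (intro ideal_prod.prod) (simp_all add: monomial_span_single)
  ultimately have "Poly_Mapping.single (a + b) (1::'k) \<in> monomial_span W" by (auto simp: mult_single)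
  then show "a + b \<in> W" by (simp add: monomial_span_single)
next
  fix f :: "'k mpoly"
  assume W: "\<forall>a\<in>U. \<forall>b\<in>V. a + b \<in> W" and "f \<in> monomial_span U \<cdot>\<^bsub>poly_ring n\<^esub> monomial_span V"
  from this(2) show "f \<in> monomial_span W"
  proof (induction rule: ideal_prod.induct)
    case (prod f g)
    then show ?case using W monomial_span_mult[of f U g V W] by simp
  qed (auto intro: monomial_span_add)
qed

section \<open>Boundary ideals in terms of exponents\<close>

lemma ideal_sum_cong:
  assumes "\<And>i. i \<in> A \<Longrightarrow> J i = J' i"
  shows "ideal_sum R A J = ideal_sum R A J'"
proof -
  have "Pi A J = Pi A J'" using assms by (auto simp: Pi_iff)
  then show ?thesis by (simp add: ideal_sum_def)
qed

lemma ideal_sum_monomial_span: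
  assumes C: "finite C" and W: "\<And>\<sigma>. \<sigma> \<in> C \<Longrightarrow> W \<sigma> \<subseteq> exponents n"
  shows "ideal_sum (poly_ring n) C (\<lambda>\<sigma>. monomial_span (W \<sigma>)) = (monomial_span (\<Union>\<sigma>\<in>C. W \<sigma>) :: 'k::field mpoly set)"
proof (intro equalityI subsetI)
  fix f :: "'k mpoly" assume "f \<in> ideal_sum (poly_ring n) C (\<lambda>\<sigma>. monomial_span (W \<sigma>))"
  then obtain g where f: "f = (\<Oplus>\<^bsub>poly_ring n\<^esub>\<sigma>\<in>C. g \<sigma>)" and g: "g \<in> (\<Pi> \<sigma>\<in>C. monomial_span (W \<sigma>))"
    by (auto simp: ideal_sum_def)
  have "f = sum g C" unfolding f
    by (rule poly_ring_finsum) (use g W monomial_span_mono in blast)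
  moreover have "g \<sigma> \<in> monomial_span (\<Union>\<sigma>\<in>C. W \<sigma>)" if "\<sigma> \<in> C" for \<sigma>
    using g that by (fastforce simp: monomial_span_def Pi_iff)
  ultimately show "f \<in> monomial_span (\<Union>\<sigma>\<in>C. W \<sigma>)" by (simp add: monomial_span_sum)
next
  fix f :: "'k mpoly" assume "f \<in> monomial_span (\<Union>\<sigma>\<in>C. W \<sigma>)"
  then have "\<forall>m\<in>Poly_Mapping.keys f. \<exists>\<sigma>. \<sigma> \<in> C \<and> m \<in> W \<sigma>" by (auto simp: monomial_span_def)
  \<comment> \<open>Each monomial of \<open>f\<close> is assigned to one summand that contains it;
    \<open>g\<close> then collects the terms of \<open>f\<close> by this choice.\<close>
  then obtain s where s: "\<And>m. m \<in> Poly_Mapping.keys f \<Longrightarrow> s m \<in> C \<and> m \<in> W (s m)" by metis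
  define g where "g \<sigma> = (\<Sum>m | m \<in> Poly_Mapping.keys f \<and> s m = \<sigma>. Poly_Mapping.single m (Poly_Mapping.lookup f m))" for \<sigma>
  have g: "g \<sigma> \<in> monomial_span (W \<sigma>)" for \<sigma>
    unfolding g_def using s by (intro monomial_span_sum) (auto simp: monomial_span_single)
  have "sum g C = (\<Sum>m\<in>Poly_Mapping.keys f. Poly_Mapping.single m (Poly_Mapping.lookup f m))"
    unfolding g_def by (rule sum.group) (use C s in auto)
  moreover have "(\<Oplus>\<^bsub>poly_ring n\<^esub>\<sigma>\<in>C. g \<sigma>) = sum g C"
    by (rule poly_ring_finsum) (use g W monomial_span_mono in blast)
  ultimately have "f = (\<Oplus>\<^bsub>poly_ring n\<^esub>\<sigma>\<in>C. g \<sigma>)" by (simp add: sum_monomials)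
  then show "f \<in> ideal_sum (poly_ring n) C (\<lambda>\<sigma>. monomial_span (W \<sigma>))"
    using g by (auto simp: ideal_sum_def)
qed

lemma prod_Var: "finite A \<Longrightarrow> prod Var A = (Poly_Mapping.single (indicator_exp A) 1 :: 'k::field mpoly)"
  by (induction A rule: finite_induct) (auto simp: indicator_exp_def Var_def mult_single)

text \<open>Describes the killed faces: x^\<nu> e_\<sigma> has the multidegree of x^\<mu> e_\<rho>
  and its coefficient lies in the ideal. The additive form avoids truncated subtraction.\<close>

definition same_degree_in :: "(nat \<Rightarrow>\<^sub>0 nat) set \<Rightarrow> nat set \<Rightarrow> (nat \<Rightarrow>\<^sub>0 nat) \<Rightarrow> nat set \<Rightarrow> bool" where
  "same_degree_in U \<rho> \<mu> \<sigma> \<longleftrightarrow> (\<exists>\<nu>\<in>U. \<nu> + indicator_exp \<sigma> = \<mu> + indicator_exp \<rho>)"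

text \<open>The exponents \<mu> and \<nu> share a part \<open>w\<close>: they are \<open>w\<close>
  plus the indicators of \<open>\<sigma> - \<rho>\<close> and \<open>\<rho> - \<sigma>\<close>, and
  both degrees equal \<open>w\<close> plus the indicator of \<open>\<sigma> \<union> \<rho>\<close>.
  So the shift and the colon in I^\<rho>_\<sigma> together express equality of degrees.\<close>

lemma shifted_colon_monomial_span:
  assumes U: "up_closed n U" and fin: "\<rho> \<subseteq> {1..n}" "\<sigma> \<subseteq> {1..n}"
  shows "shifted_colon n (monomial_span U) \<rho> \<sigma> =
    (monomial_span {\<mu> \<in> exponents n. same_degree_in U \<rho> \<mu> \<sigma>} :: 'k::field mpoly set)"
proof -
  have f: "finite \<rho>" "finite \<sigma>" using fin finite_subset by auto
  let ?e = indicator_exp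
  let ?W = "{w \<in> exponents n. ?e (\<rho> - \<sigma>) + w \<in> U}"
  have "colon (poly_ring n) (monomial_span U) {prod Var (\<rho> - \<sigma>)} = (monomial_span ?W :: 'k mpoly set)"
    using f by (auto simp: colon_def prod_Var mult.commute[of _ "Poly_Mapping.single _ _"]
        single_mult_mem_monomial_span) (auto simp: monomial_span_def)
  then have "shifted_colon n (monomial_span U) \<rho> \<sigma> = (monomial_span ((\<lambda>m. ?e (\<sigma> - \<rho>) + m) ` ?W) :: 'k mpoly set)"
    using f by (simp add: shifted_colon_def prod_Var image_single_mult)
  moreover have "(\<lambda>m. ?e (\<sigma> - \<rho>) + m) ` ?W = {\<mu> \<in> exponents n. same_degree_in U \<rho> \<mu> \<sigma>}"
  proof (intro equalityI subsetI)
    have e: "?e \<alpha> = ?e (\<alpha> - \<beta>) + ?e (\<alpha> \<inter> \<beta>)" if "finite \<alpha>" for \<alpha> \<beta>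
      using that by (subst indicator_exp_Un[symmetric]) (auto intro!: arg_cong[of _ _ ?e])
    fix \<mu> assume "\<mu> \<in> (\<lambda>m. ?e (\<sigma> - \<rho>) + m) ` ?W"
    then obtain w where w: "w \<in> exponents n" "?e (\<rho> - \<sigma>) + w \<in> U" "\<mu> = ?e (\<sigma> - \<rho>) + w" by auto
    have "?e (\<rho> - \<sigma>) + w + ?e \<sigma> = \<mu> + ?e \<rho>"
      unfolding w(3) e[OF f(1), of \<sigma>] e[OF f(2), of \<rho>] by (simp add: add_ac Int_commute)
    moreover have "\<mu> \<in> exponents n"
      using w fin by (auto simp: exponents_add intro!: exponents_indicator)
    ultimately show "\<mu> \<in> {\<mu> \<in> exponents n. same_degree_in U \<rho> \<mu> \<sigma>}"
      using w(2) by (auto simp: same_degree_in_def)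
  next
    fix \<mu> assume "\<mu> \<in> {\<mu> \<in> exponents n. same_degree_in U \<rho> \<mu> \<sigma>}"
    then obtain \<nu> where \<mu>: "\<mu> \<in> exponents n" and \<nu>: "\<nu> \<in> U" "\<nu> + ?e \<sigma> = \<mu> + ?e \<rho>"
      by (auto simp: same_degree_in_def)
    \<comment> \<open>The subtraction is exact: on \<open>\<sigma> - \<rho>\<close> the equality of
      degrees forces \<mu> to be at least 1.\<close>
    define w where "w = \<mu> - ?e (\<sigma> - \<rho>)"
    have l: "Poly_Mapping.lookup \<nu> i + (if i \<in> \<sigma> then 1 else 0) =
      Poly_Mapping.lookup \<mu> i + (if i \<in> \<rho> then 1 else 0)" for i
      using arg_cong[OF \<nu>(2), of "\<lambda>m. Poly_Mapping.lookup m i"] f by (simp add: lookup_add lookup_indicator_exp)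
    have 1: "?e (\<sigma> - \<rho>) + w = \<mu>"
    proof (rule poly_mapping_eqI)
      fix i show "Poly_Mapping.lookup (?e (\<sigma> - \<rho>) + w) i = Poly_Mapping.lookup \<mu> i"
        using l[of i] f by (auto simp: w_def lookup_add lookup_minus lookup_indicator_exp split: if_splits)
    qed
    have 2: "?e (\<rho> - \<sigma>) + w = \<nu>"
    proof (rule poly_mapping_eqI)
      fix i show "Poly_Mapping.lookup (?e (\<rho> - \<sigma>) + w) i = Poly_Mapping.lookup \<nu> i"
        using l[of i] f by (auto simp: w_def lookup_add lookup_minus lookup_indicator_exp split: if_splits)
    qed
    have "w \<in> exponents n" using \<mu> 1 exponents_add by metis
    then show "\<mu> \<in> (\<lambda>m. ?e (\<sigma> - \<rho>) + m) ` ?W" using 1 2 \<nu>(1) by (intro image_eqI[of _ _ w]) auto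
  qed
  ultimately show ?thesis by simp
qed

definition boundary_exponents :: "'k::field itself \<Rightarrow> nat \<Rightarrow> (nat \<Rightarrow>\<^sub>0 nat) set \<Rightarrow> nat set \<Rightarrow> (nat \<Rightarrow>\<^sub>0 nat) set" where
  "boundary_exponents k n U \<rho> = {\<mu> \<in> exponents n.
    if \<rho> = {1..n} then \<mu> \<in> U
    else \<forall>C\<in>circuits k n (card \<rho>). \<rho> \<in> C \<longrightarrow> (\<exists>\<sigma>\<in>C. same_degree_in U \<rho> \<mu> \<sigma>)}"

text \<open>Passing to spans turns the union over a circuit into a sum of ideals, and the
  intersection of exponent sets into the intersection of ideals.\<close>

lemma boundary_ideal_monomial_span:
  assumes U: "up_closed n U" and \<rho>: "\<rho> \<subseteq> {1..n}"
  shows "boundary_ideal n (monomial_span U) \<rho> = (monomial_span (boundary_exponents TYPE('k) n U \<rho>) :: 'k::field mpoly set)"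
proof (cases "\<rho> = {1..n}")
  case True
  have "{\<mu> \<in> exponents n. \<mu> \<in> U} = U" using U by (auto simp: up_closed_def)
  then show ?thesis using True by (simp add: boundary_ideal_def boundary_exponents_def)
next
  case False
  have sum: "ideal_sum (poly_ring n) C (shifted_colon n (monomial_span U) \<rho>) =
      (monomial_span (\<Union>\<sigma>\<in>C. {\<mu> \<in> exponents n. same_degree_in U \<rho> \<mu> \<sigma>}) :: 'k mpoly set)"
    if C: "C \<in> circuits TYPE('k) n (card \<rho>)" for C
  proof -
    have s: "\<sigma> \<subseteq> {1..n}" if "\<sigma> \<in> C" for \<sigma>
      using C that by (auto simp: circuits_def subsets_of_card_def)
    have "ideal_sum (poly_ring n) C (shifted_colon n (monomial_span U) \<rho>) =
        ideal_sum (poly_ring n) C (\<lambda>\<sigma>. (monomial_span {\<mu> \<in> exponents n. same_degree_in U \<rho> \<mu> \<sigma>} :: 'k mpoly set))"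
      by (rule ideal_sum_cong) (rule shifted_colon_monomial_span[OF U \<rho> s])
    also have "\<dots> = monomial_span (\<Union>\<sigma>\<in>C. {\<mu> \<in> exponents n. same_degree_in U \<rho> \<mu> \<sigma>})"
      by (rule ideal_sum_monomial_span[OF finite_circuit[OF C]]) auto
    finally show ?thesis .
  qed
  have "boundary_ideal n (monomial_span U) \<rho> = monomial_span (exponents n) \<inter>
      (\<Inter>C\<in>{C \<in> circuits TYPE('k) n (card \<rho>). \<rho> \<in> C}.
        (monomial_span (\<Union>\<sigma>\<in>C. {\<mu> \<in> exponents n. same_degree_in U \<rho> \<mu> \<sigma>}) :: 'k mpoly set))"
    unfolding boundary_ideal_def using False by (auto simp: sum)
  also have "\<dots> = monomial_span (boundary_exponents TYPE('k) n U \<rho>)"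
  proof -
    have "boundary_exponents TYPE('k) n U \<rho> = exponents n \<inter>
        (\<Inter>C\<in>{C \<in> circuits TYPE('k) n (card \<rho>). \<rho> \<in> C}. \<Union>\<sigma>\<in>C. {\<mu> \<in> exponents n. same_degree_in U \<rho> \<mu> \<sigma>})"
      unfolding boundary_exponents_def if_not_P[OF False] by auto
    then show ?thesis unfolding monomial_span_def by (simp only:) blast
  qed
  finally show ?thesis .
qed


section \<open>Boundaries among monomial chains\<close>

text \<open>Expresses on polynomial representatives that the class of \<open>c\<close> over S/I is a
  boundary; \<open>chain_class_boundaries\<close> makes the link.\<close>

definition boundary_mod :: "nat \<Rightarrow> (nat \<Rightarrow>\<^sub>0 nat) set \<Rightarrow> (nat set \<Rightarrow> 'k::field mpoly) \<Rightarrow> bool" where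
  "boundary_mod n U c \<longleftrightarrow> (\<exists>F. (\<forall>\<sigma>\<subseteq>{1..n}. F \<sigma> \<in> monomial_span (exponents n)) \<and>
    (\<forall>\<sigma>\<subseteq>{1..n}. kdiff n Var F \<sigma> - c \<sigma> \<in> monomial_span U))"

text \<open>Extracts one multidegree \<open>M\<close>: the coefficient of x^\<nu> at e_\<sigma> only
  sees the part of \<open>F\<close> in degree \<open>M\<close>. For \<tau> outside the support of
  \<open>M\<close> there is no such part and \<open>M - indicator_exp \<tau>\<close> would be
  truncated, hence the default 0.\<close>

lemma lookup_kdiff_Var:
  assumes \<sigma>: "\<sigma> \<subseteq> {1..n}" and M: "\<nu> + indicator_exp \<sigma> = M" and Mn: "M \<in> exponents n"
  shows "Poly_Mapping.lookup (kdiff n Var F \<sigma>) \<nu> =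
    kdiff n (\<lambda>_. 1) (\<lambda>\<tau>. if \<tau> \<subseteq> Poly_Mapping.keys M
      then Poly_Mapping.lookup (F \<tau> :: 'k::field mpoly) (M - indicator_exp \<tau>) else 0) \<sigma>"
proof -
  have fin: "finite \<sigma>" using \<sigma> finite_subset by blast
  have sA: "\<sigma> \<subseteq> Poly_Mapping.keys M" using M fin by (auto simp: keys_add_nat keys_indicator_exp)
  show ?thesis unfolding kdiff_def lookup_sum lookup_sign_mult[OF koszul_sgn_cases]
  proof (intro sum.cong refl arg_cong[of _ _ "(*) _"])
    fix j assume j: "j \<in> {1..n} - \<sigma>"
    show "Poly_Mapping.lookup (Var j * F (insert j \<sigma>)) \<nu> =
      1 * (if insert j \<sigma> \<subseteq> Poly_Mapping.keys M
        then Poly_Mapping.lookup (F (insert j \<sigma>)) (M - indicator_exp (insert j \<sigma>)) else 0)"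
    proof (cases "j \<in> Poly_Mapping.keys M")
      case True
      let ?x = "Poly_Mapping.single j (1::nat)"
      have "j \<in> Poly_Mapping.keys \<nu>" using True j fin unfolding M[symmetric] by (auto simp: keys_add_nat keys_indicator_exp)
      then have "\<nu> = ?x + (\<nu> - ?x)"
        by (intro poly_mapping_eqI) (auto simp: lookup_add lookup_minus lookup_single when_def in_keys_iff)
      then obtain \<nu>' where n': "\<nu> = ?x + \<nu>'" by blast
      have "M = \<nu>' + indicator_exp (insert j \<sigma>)"
        using j fin unfolding M[symmetric] n' by (simp add: indicator_exp_insert add_ac)
      then have "M - indicator_exp (insert j \<sigma>) = \<nu>'" by simp
      then show ?thesis using True sA by (simp add: n' Var_def lookup_single_mult)
    next
      case False
      \<comment> \<open>Here x_j does not divide x^\<nu>, so no multiple of \<open>Var j\<close>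
        contains this monomial.\<close>
      have "\<nu> \<noteq> Poly_Mapping.single j 1 + \<nu>'" for \<nu>'
        using False unfolding M[symmetric] by (auto simp: keys_add_nat)
      then show ?thesis using False by (simp add: Var_def lookup_single_mult_eq_0)
    qed
  qed
qed

lemma single_sum: "Poly_Mapping.single k (sum f A) = (\<Sum>i\<in>A. Poly_Mapping.single k (f i))"
  by (induction A rule: infinite_finite_induct) (simp_all add: single_add)

lemma degree_split:
  assumes "\<sigma> \<subseteq> Poly_Mapping.keys M"
  shows "M - indicator_exp \<sigma> + indicator_exp \<sigma> = M"
proof (rule poly_mapping_eqI)
  fix i
  have "finite \<sigma>" using assms finite_subset finite_keys by blast
  then show "Poly_Mapping.lookup (M - indicator_exp \<sigma> + indicator_exp \<sigma>) i = Poly_Mapping.lookup M i"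
    using assms by (auto simp: lookup_add lookup_minus lookup_indicator_exp in_keys_iff Suc_leI)
qed

text \<open>The Koszul complex is graded by \<open>\<nat>\<^sup>n\<close>, the degree of \<open>x\<^sup>\<nu> e\<^sub>\<sigma>\<close> being \<open>\<nu> + indicator_exp \<sigma>\<close>.
  In the degree of \<open>x\<^sup>\<mu> e\<^sub>\<rho>\<close> it is the simplicial chain complex of the simplex on \<open>keys (\<mu> + indicator_exp \<rho>)\<close>.\<close>

lemma boundary_mod_iff_solution:
  assumes U: "up_closed n U" and \<rho>: "\<rho> \<subseteq> {1..n}" and \<mu>: "\<mu> \<in> exponents n"
  shows "boundary_mod n U (\<lambda>\<sigma>. if \<sigma> = \<rho> then Poly_Mapping.single \<mu> 1 else (0 :: 'k::field mpoly)) \<longleftrightarrow>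
    (\<exists>a :: nat set \<Rightarrow> 'k. (\<forall>\<sigma>. a \<sigma> \<noteq> 0 \<longrightarrow> \<sigma> \<subseteq> Poly_Mapping.keys (\<mu> + indicator_exp \<rho>)) \<and>
      (\<forall>\<sigma>. \<sigma> \<subseteq> {1..n} \<and> kdiff n (\<lambda>_. 1) a \<sigma> \<noteq> (if \<sigma> = \<rho> then 1 else 0) \<longrightarrow> same_degree_in U \<rho> \<mu> \<sigma>))"
    (is "boundary_mod n U ?c \<longleftrightarrow> ?R")
proof -
  define M where "M = \<mu> + indicator_exp \<rho>"
  let ?A = "Poly_Mapping.keys M"
  have Mn: "M \<in> exponents n" using \<mu> \<rho> by (simp add: M_def exponents_add exponents_indicator)
  have fin: "finite \<rho>" using \<rho> finite_subset by blast
  have \<rho>A: "\<rho> \<subseteq> ?A" using fin by (simp add: M_def keys_add_nat keys_indicator_exp)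
  have An: "?A \<subseteq> {1..n}" using Mn by (simp add: exponents_def)
  have same: "same_degree_in U \<rho> \<mu> \<sigma> \<longleftrightarrow> M - indicator_exp \<sigma> \<in> U" if "\<sigma> \<subseteq> ?A" for \<sigma>
    using degree_split[OF that] unfolding same_degree_in_def M_def[symmetric]
    by (metis add_diff_cancel_right')
  have Mr: "M - indicator_exp \<rho> = \<mu>" by (simp add: M_def)
  show ?thesis unfolding M_def[symmetric]
  proof
    assume "boundary_mod n U ?c"
    then obtain F :: "nat set \<Rightarrow> 'k mpoly" where
      F: "\<And>\<sigma>. \<sigma> \<subseteq> {1..n} \<Longrightarrow> kdiff n Var F \<sigma> - ?c \<sigma> \<in> monomial_span U"
      by (auto simp: boundary_mod_def)
    \<comment> \<open>The component of \<open>F\<close> in degree \<open>M\<close>, with its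
      monomials stripped off.\<close>
    define a where "a \<tau> = (if \<tau> \<subseteq> ?A then Poly_Mapping.lookup (F \<tau>) (M - indicator_exp \<tau>) else 0)" for \<tau>
    have "same_degree_in U \<rho> \<mu> \<sigma>"
      if \<sigma>: "\<sigma> \<subseteq> {1..n}" and ne: "kdiff n (\<lambda>_. 1) a \<sigma> \<noteq> (if \<sigma> = \<rho> then 1 else 0)" for \<sigma>
    proof -
      have \<sigma>A: "\<sigma> \<subseteq> ?A"
      proof (rule ccontr)
        assume n: "\<not> \<sigma> \<subseteq> ?A"
        then have "kdiff n (\<lambda>_. 1) a \<sigma> = 0" by (simp add: kdiff_def a_def)
        then show False using ne n \<rho>A by (auto split: if_splits)
      qed
      let ?\<nu> = "M - indicator_exp \<sigma>"
      have "Poly_Mapping.lookup (kdiff n Var F \<sigma>) ?\<nu> = kdiff n (\<lambda>_. 1) a \<sigma>"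
        unfolding a_def by (rule lookup_kdiff_Var[OF \<sigma> degree_split[OF \<sigma>A] Mn])
      moreover have "Poly_Mapping.lookup (?c \<sigma>) ?\<nu> = (if \<sigma> = \<rho> then 1 else 0)"
        by (simp add: Mr)
      ultimately have "Poly_Mapping.lookup (kdiff n Var F \<sigma> - ?c \<sigma>) ?\<nu> \<noteq> 0"
        using ne by (simp only: lookup_minus right_minus_eq not_False_eq_True)
      then have "?\<nu> \<in> U" using F[OF \<sigma>, unfolded mem_monomial_span] by blast
      then show ?thesis using same[OF \<sigma>A] by simp
    qed
    moreover have "\<sigma> \<subseteq> ?A" if "a \<sigma> \<noteq> 0" for \<sigma> using that by (auto simp: a_def split: if_splits)
    ultimately show "\<exists>a :: nat set \<Rightarrow> 'k. (\<forall>\<sigma>. a \<sigma> \<noteq> 0 \<longrightarrow> \<sigma> \<subseteq> ?A) \<and>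
      (\<forall>\<sigma>. \<sigma> \<subseteq> {1..n} \<and> kdiff n (\<lambda>_. 1) a \<sigma> \<noteq> (if \<sigma> = \<rho> then 1 else 0) \<longrightarrow> same_degree_in U \<rho> \<mu> \<sigma>)"
      by (intro exI[of _ a]) (metis (no_types))
  next
    assume "\<exists>a :: nat set \<Rightarrow> 'k. (\<forall>\<sigma>. a \<sigma> \<noteq> 0 \<longrightarrow> \<sigma> \<subseteq> ?A) \<and>
      (\<forall>\<sigma>. \<sigma> \<subseteq> {1..n} \<and> kdiff n (\<lambda>_. 1) a \<sigma> \<noteq> (if \<sigma> = \<rho> then 1 else 0) \<longrightarrow> same_degree_in U \<rho> \<mu> \<sigma>)"
    then obtain a :: "nat set \<Rightarrow> 'k" where a0: "\<forall>\<sigma>. a \<sigma> \<noteq> 0 \<longrightarrow> \<sigma> \<subseteq> ?A"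
      and a: "\<forall>\<sigma>. \<sigma> \<subseteq> {1..n} \<and> kdiff n (\<lambda>_. 1) a \<sigma> \<noteq> (if \<sigma> = \<rho> then 1 else 0) \<longrightarrow> same_degree_in U \<rho> \<mu> \<sigma>"
      by (elim exE conjE)
    \<comment> \<open>The homogeneous lift of \<open>a\<close> to degree \<open>M\<close>. Where the
      exponent would be truncated, \<open>a\<close> vanishes.\<close>
    define F where "F \<tau> = Poly_Mapping.single (M - indicator_exp \<tau>) (a \<tau>)" for \<tau>
    have Fn: "F \<sigma> \<in> monomial_span (exponents n)" for \<sigma>
    proof (cases "a \<sigma> = 0")
      case False
      then have "M - indicator_exp \<sigma> + indicator_exp \<sigma> = M" using a0 degree_split by blast
      then show ?thesis using Mn exponents_add unfolding F_def monomial_span_single by metis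
    qed (simp add: F_def)
    have "kdiff n Var F \<sigma> - ?c \<sigma> \<in> monomial_span U" if \<sigma>: "\<sigma> \<subseteq> {1..n}" for \<sigma>
    proof (cases "\<sigma> \<subseteq> ?A")
      case False
      have "a (insert j \<sigma>) = 0" for j using False a0 by blast
      then have "F (insert j \<sigma>) = 0" for j by (simp add: F_def)
      then have "kdiff n Var F \<sigma> = 0" by (simp add: kdiff_def)
      moreover have "\<sigma> \<noteq> \<rho>" using False \<rho>A by auto
      ultimately show ?thesis by simp
    next
      case True
      let ?\<nu> = "M - indicator_exp \<sigma>"
      have fs: "finite \<sigma>" using \<sigma> finite_subset by blast
      have "kdiff n Var F \<sigma> = Poly_Mapping.single ?\<nu> (kdiff n (\<lambda>_. 1) a \<sigma>)"
        unfolding kdiff_def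
      proof (subst single_sum, intro sum.cong refl)
        fix j assume j: "j \<in> {1..n} - \<sigma>"
        have "Var j * F (insert j \<sigma>) = Poly_Mapping.single ?\<nu> (a (insert j \<sigma>))"
        proof (cases "a (insert j \<sigma>) = 0")
          case False
          then have "M - indicator_exp (insert j \<sigma>) + indicator_exp (insert j \<sigma>) = M" using a0 degree_split by blast
          then have "M = (Poly_Mapping.single j 1 + (M - indicator_exp (insert j \<sigma>))) + indicator_exp \<sigma>"
            using j fs by (simp add: indicator_exp_insert add_ac)
          then have "?\<nu> = Poly_Mapping.single j 1 + (M - indicator_exp (insert j \<sigma>))"
            by (metis add_diff_cancel_right')
          then show ?thesis by (simp add: F_def Var_def mult_single)
        qed (simp add: F_def)
        then show "of_int (koszul_sgn \<sigma> j) * (Var j * F (insert j \<sigma>)) =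
          Poly_Mapping.single ?\<nu> (of_int (koszul_sgn \<sigma> j) * (1 * a (insert j \<sigma>)))"
          using koszul_sgn_cases[of \<sigma> j] by (auto simp: single_uminus)
      qed
      moreover have "?c \<sigma> = Poly_Mapping.single ?\<nu> (if \<sigma> = \<rho> then 1 else 0)" by (simp add: Mr)
      ultimately have "kdiff n Var F \<sigma> - ?c \<sigma> =
          Poly_Mapping.single ?\<nu> (kdiff n (\<lambda>_. 1) a \<sigma> - (if \<sigma> = \<rho> then 1 else 0))"
        by (simp only: single_diff)
      moreover have "?\<nu> \<in> U" if "kdiff n (\<lambda>_. 1) a \<sigma> \<noteq> (if \<sigma> = \<rho> then 1 else 0)"
        using a[rule_format, OF conjI, OF \<sigma> that] same[OF True] by simp
      ultimately show ?thesis by (auto simp only: monomial_span_single right_minus_eq)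
    qed
    then show "boundary_mod n U ?c" unfolding boundary_mod_def using Fn by (intro exI[of _ F]) simp
  qed
qed

text \<open>Joins the restriction to one degree with the circuit criterion. A killed face lies in
  the support of the common degree, as the criterion demands, and \<rho> itself is killed exactly
  when x^\<mu> lies in the ideal, which settles the case of the full set.\<close>

lemma boundary_mod_monomial_iff:
  assumes U: "up_closed n U" and \<rho>: "\<rho> \<subseteq> {1..n}" "\<rho> \<noteq> {}" and \<mu>: "\<mu> \<in> exponents n"
  shows "boundary_mod n U (\<lambda>\<sigma>. if \<sigma> = \<rho> then Poly_Mapping.single \<mu> 1 else (0 :: 'k::field mpoly)) \<longleftrightarrow>
    \<mu> \<in> boundary_exponents TYPE('k) n U \<rho>"
proof -
  have fin: "finite \<rho>" using \<rho> finite_subset by blast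
  have 1: "\<rho> \<subseteq> Poly_Mapping.keys (\<mu> + indicator_exp \<rho>)"
    using fin by (simp add: keys_add_nat keys_indicator_exp)
  have 2: "Poly_Mapping.keys (\<mu> + indicator_exp \<rho>) \<subseteq> {1..n}"
    using \<mu> \<rho> fin by (simp add: keys_add_nat keys_indicator_exp exponents_def)
  have 3: "\<sigma> \<subseteq> Poly_Mapping.keys (\<mu> + indicator_exp \<rho>)"
    if s: "\<sigma> \<subseteq> {1..n}" "same_degree_in U \<rho> \<mu> \<sigma>" for \<sigma>
  proof -
    have "finite \<sigma>" using s finite_subset by blast
    moreover obtain \<nu> where "\<nu> + indicator_exp \<sigma> = \<mu> + indicator_exp \<rho>"
      using s(2) unfolding same_degree_in_def by blast
    then have "Poly_Mapping.keys (\<nu> + indicator_exp \<sigma>) = Poly_Mapping.keys (\<mu> + indicator_exp \<rho>)" by simp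
    ultimately show ?thesis by (simp add: keys_add_nat keys_indicator_exp) blast
  qed
  have 4: "same_degree_in U \<rho> \<mu> \<rho> \<longleftrightarrow> \<mu> \<in> U" by (auto simp: same_degree_in_def)
  show ?thesis
  proof (rule trans[OF boundary_mod_iff_solution[OF U \<rho>(1) \<mu>] trans[OF boundary_solution_iff_circuits[OF 1 \<rho>(2) 2]]])
    show "(if \<rho> = {1..n} then same_degree_in U \<rho> \<mu> \<rho>
        else \<forall>C\<in>circuits TYPE('k) n (card \<rho>). \<rho> \<in> C \<longrightarrow> (\<exists>\<sigma>\<in>C. same_degree_in U \<rho> \<mu> \<sigma>))
      \<longleftrightarrow> \<mu> \<in> boundary_exponents TYPE('k) n U \<rho>"
      by (simp only: boundary_exponents_def mem_Collect_eq 4 \<mu> simp_thms)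
  qed (rule 3)
qed


section \<open>Products of boundaries and cycles\<close>

text \<open>Only the values on subsets of [n] are constrained; \<open>chain_class\<close> forgets
  the others.\<close>

definition koszul_chains :: "nat \<Rightarrow> (nat set \<Rightarrow> 'k::field mpoly) set" where
  "koszul_chains n = {c. \<forall>\<sigma>\<subseteq>{1..n}. c \<sigma> \<in> monomial_span (exponents n)}"

definition cycle_mod :: "nat \<Rightarrow> (nat \<Rightarrow>\<^sub>0 nat) set \<Rightarrow> (nat set \<Rightarrow> 'k::field mpoly) \<Rightarrow> bool" where
  "cycle_mod n U c \<longleftrightarrow> (\<forall>\<sigma>\<subseteq>{1..n}. kdiff n Var c \<sigma> \<in> monomial_span U)"

lemma boundary_modI:
  "F \<in> koszul_chains n \<Longrightarrow> (\<And>\<sigma>. \<sigma> \<subseteq> {1..n} \<Longrightarrow> kdiff n Var F \<sigma> - c \<sigma> \<in> monomial_span U) \<Longrightarrow> boundary_mod n U c"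
  by (auto simp: boundary_mod_def koszul_chains_def)

lemma boundary_modE:
  assumes "boundary_mod n U c"
  obtains F where "F \<in> koszul_chains n" "\<And>\<sigma>. \<sigma> \<subseteq> {1..n} \<Longrightarrow> kdiff n Var F \<sigma> - c \<sigma> \<in> monomial_span U"
  using assms by (auto simp: boundary_mod_def koszul_chains_def)

lemma chains_zero: "(\<lambda>_. 0) \<in> koszul_chains n"
  by (simp add: koszul_chains_def)

lemma chains_add: "c \<in> koszul_chains n \<Longrightarrow> d \<in> koszul_chains n \<Longrightarrow> (\<lambda>\<sigma>. c \<sigma> + d \<sigma>) \<in> koszul_chains n"
  by (simp add: koszul_chains_def monomial_span_add)

lemma chains_uminus: "c \<in> koszul_chains n \<Longrightarrow> (\<lambda>\<sigma>. - c \<sigma>) \<in> koszul_chains n"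
  by (simp add: koszul_chains_def monomial_span_uminus)

lemma chains_alternate: "c \<in> koszul_chains n \<Longrightarrow> (\<lambda>\<sigma>. (-1) ^ card \<sigma> * c \<sigma>) \<in> koszul_chains n"
  by (simp add: koszul_chains_def minus_one_power_iff monomial_span_uminus)

lemma monomial_span_Var: "j \<in> {1..n} \<Longrightarrow> Var j \<in> monomial_span (exponents n)"
  by (simp add: Var_def monomial_span_single exponents_single_iff[unfolded One_nat_def])

lemma monomial_span_kdiff:
  assumes "up_closed n U" "\<And>\<sigma>. \<sigma> \<subseteq> {1..n} \<Longrightarrow> c \<sigma> \<in> monomial_span U" "\<sigma> \<subseteq> {1..n}"
  shows "kdiff n Var c \<sigma> \<in> monomial_span U"
  unfolding kdiff_def using assms
  by (intro monomial_span_sum monomial_span_sign[OF koszul_sgn_cases] monomial_span_mult_right(2) monomial_span_Var) auto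

lemma chains_kdiff: "c \<in> koszul_chains n \<Longrightarrow> kdiff n Var c \<in> koszul_chains n"
  using monomial_span_kdiff[OF up_closed_exponents] by (auto simp: koszul_chains_def)

lemma monomial_span_kmult:
  assumes "up_closed n U" "\<And>\<sigma>. \<sigma> \<subseteq> {1..n} \<Longrightarrow> c \<sigma> \<in> monomial_span U" "d \<in> koszul_chains n" "\<sigma> \<subseteq> {1..n}"
  shows "kmult c d \<sigma> \<in> monomial_span U" "kmult d c \<sigma> \<in> monomial_span U"
proof -
  have *: "\<tau> \<subseteq> {1..n} \<and> \<sigma> - \<tau> \<subseteq> {1..n}" if "\<tau> \<in> Pow \<sigma>" for \<tau> using that assms(4) by auto
  show "kmult c d \<sigma> \<in> monomial_span U" unfolding kmult_def using assms(2,3) *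
    by (intro monomial_span_sum monomial_span_sign[OF wedge_sgn_cases] monomial_span_mult_right(1)[OF assms(1)])
      (auto simp: koszul_chains_def)
  show "kmult d c \<sigma> \<in> monomial_span U" unfolding kmult_def using assms(2,3) *
    by (intro monomial_span_sum monomial_span_sign[OF wedge_sgn_cases] monomial_span_mult_right(2)[OF assms(1)])
      (auto simp: koszul_chains_def)
qed

lemma chains_kmult: "c \<in> koszul_chains n \<Longrightarrow> d \<in> koszul_chains n \<Longrightarrow> kmult c d \<in> koszul_chains n"
  unfolding koszul_chains_def mem_Collect_eq
  by (intro allI impI monomial_span_kmult(1)[OF up_closed_exponents]) (auto simp: koszul_chains_def)

section \<open>Linearity, and boundaries modulo the ideal\<close>

lemma kdiff_add: "kdiff n x (\<lambda>\<sigma>. c \<sigma> + d \<sigma>) \<sigma> = kdiff n x c \<sigma> + kdiff n x d \<sigma>"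
  by (simp add: kdiff_def distrib_left sum.distrib)

lemma kdiff_uminus: "kdiff n x (\<lambda>\<sigma>. - c \<sigma>) \<sigma> = - kdiff n x c \<sigma>"
  by (simp add: kdiff_def sum_negf)

lemma kdiff_alternate:
  assumes "\<sigma> \<subseteq> {1..n}"
  shows "kdiff n x (\<lambda>\<sigma>. (-1) ^ card \<sigma> * c \<sigma>) \<sigma> = - ((-1) ^ card \<sigma> * kdiff n x c \<sigma>)"
proof -
  have "finite \<sigma>" using assms finite_subset by blast
  then show ?thesis
    unfolding kdiff_def by (auto simp: sum_distrib_left algebra_simps simp flip: sum_negf intro!: sum.cong)
qed

lemma kmult_add_left: "kmult (\<lambda>\<sigma>. c \<sigma> + c' \<sigma>) d \<sigma> = kmult c d \<sigma> + kmult c' d \<sigma>"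
  by (simp add: kmult_def distrib_left distrib_right sum.distrib)

lemma kmult_add_right: "kmult c (\<lambda>\<sigma>. d \<sigma> + d' \<sigma>) \<sigma> = kmult c d \<sigma> + kmult c d' \<sigma>"
  by (simp add: kmult_def distrib_left distrib_right sum.distrib)

lemma boundary_mod_cong:
  assumes "\<And>\<sigma>. \<sigma> \<subseteq> {1..n} \<Longrightarrow> c \<sigma> - d \<sigma> \<in> monomial_span U"
  shows "boundary_mod n U c \<longleftrightarrow> boundary_mod n U d"
proof -
  have "e - c \<sigma> \<in> monomial_span U \<longleftrightarrow> e - d \<sigma> \<in> monomial_span U" if "\<sigma> \<subseteq> {1..n}" for e \<sigma>
    using monomial_span_add[of "e - c \<sigma>" U "c \<sigma> - d \<sigma>"] monomial_span_diff[of "e - d \<sigma>" U "c \<sigma> - d \<sigma>"] assms[OF that]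
    by auto
  then show ?thesis by (auto simp: boundary_mod_def)
qed

lemma boundary_mod_zero: "boundary_mod n U (\<lambda>_. 0)"
  by (rule boundary_modI[of "\<lambda>_. 0"]) (auto simp: chains_zero kdiff_def)

lemma boundary_mod_add:
  assumes "boundary_mod n U c" "boundary_mod n U d"
  shows "boundary_mod n U (\<lambda>\<sigma>. c \<sigma> + d \<sigma>)"
proof -
  obtain F G where F: "F \<in> koszul_chains n" "\<And>\<sigma>. \<sigma> \<subseteq> {1..n} \<Longrightarrow> kdiff n Var F \<sigma> - c \<sigma> \<in> monomial_span U"
    and G: "G \<in> koszul_chains n" "\<And>\<sigma>. \<sigma> \<subseteq> {1..n} \<Longrightarrow> kdiff n Var G \<sigma> - d \<sigma> \<in> monomial_span U"
    using assms by (metis boundary_modE)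
  show ?thesis
  proof (rule boundary_modI[OF chains_add[OF F(1) G(1)]])
    fix \<sigma> assume s: "\<sigma> \<subseteq> {1..n}"
    show "kdiff n Var (\<lambda>\<sigma>. F \<sigma> + G \<sigma>) \<sigma> - (c \<sigma> + d \<sigma>) \<in> monomial_span U"
      using monomial_span_add[OF F(2)[OF s] G(2)[OF s]] by (simp add: kdiff_add algebra_simps)
  qed
qed

lemma boundary_mod_uminus:
  assumes "boundary_mod n U c"
  shows "boundary_mod n U (\<lambda>\<sigma>. - c \<sigma>)"
proof -
  obtain F where F: "F \<in> koszul_chains n" "\<And>\<sigma>. \<sigma> \<subseteq> {1..n} \<Longrightarrow> kdiff n Var F \<sigma> - c \<sigma> \<in> monomial_span U"
    using assms by (metis boundary_modE)
  show ?thesis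
  proof (rule boundary_modI[OF chains_uminus[OF F(1)]])
    fix \<sigma> assume s: "\<sigma> \<subseteq> {1..n}"
    show "kdiff n Var (\<lambda>\<sigma>. - F \<sigma>) \<sigma> - (- c \<sigma>) \<in> monomial_span U"
      using monomial_span_uminus[OF F(2)[OF s]] by (simp add: kdiff_uminus algebra_simps)
  qed
qed

lemma boundary_mod_sign:
  assumes "s = 1 \<or> s = -1"
  shows "boundary_mod n U (\<lambda>\<sigma>. of_int s * c \<sigma>) \<longleftrightarrow> boundary_mod n U c"
  using assms boundary_mod_uminus[of n U c] boundary_mod_uminus[of n U "\<lambda>\<sigma>. - c \<sigma>"] by auto

lemma boundary_mod_kdiff: "F \<in> koszul_chains n \<Longrightarrow> boundary_mod n U (kdiff n Var F)"
  by (rule boundary_modI[of F]) auto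

text \<open>A primitive is \<open>kmult F d\<close>: the other term of the Leibniz rule contains the
  boundary of \<open>d\<close>, which vanishes modulo the ideal.\<close>

lemma boundary_mod_kmult_kdiff_left:
  assumes U: "up_closed n U" and F: "F \<in> koszul_chains n" and d: "d \<in> koszul_chains n" "cycle_mod n U d"
  shows "boundary_mod n U (kmult (kdiff n Var F) d)"
proof (rule boundary_modI[OF chains_kmult[OF F d(1)]])
  fix \<sigma> :: "nat set" assume s: "\<sigma> \<subseteq> {1..n}"
  have "kmult (\<lambda>\<sigma>. (-1) ^ card \<sigma> * F \<sigma>) (kdiff n Var d) \<sigma> \<in> monomial_span U"
    using d(2) s by (intro monomial_span_kmult(2)[OF U] chains_alternate[OF F]) (auto simp: cycle_mod_def)
  then show "kdiff n Var (kmult F d) \<sigma> - kmult (kdiff n Var F) d \<sigma> \<in> monomial_span U"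
    by (simp add: kdiff_kmult[OF s])
qed

text \<open>A primitive is the product with \<open>G\<close> after \<open>c\<close> has been
  multiplied by \<open>(-1) ^ card \<sigma>\<close>, so that the sign of the Leibniz rule squares to
  1.\<close>

lemma boundary_mod_kmult_kdiff_right:
  assumes U: "up_closed n U" and G: "G \<in> koszul_chains n" and c: "c \<in> koszul_chains n" "cycle_mod n U c"
  shows "boundary_mod n U (kmult c (kdiff n Var G))"
proof (rule boundary_modI[OF chains_kmult[OF chains_alternate[OF c(1)] G]])
  fix \<sigma> :: "nat set" assume s: "\<sigma> \<subseteq> {1..n}"
  let ?c = "\<lambda>\<sigma>. (-1) ^ card \<sigma> * c \<sigma>"
  have "kdiff n Var ?c \<tau> \<in> monomial_span U" if "\<tau> \<subseteq> {1..n}" for \<tau>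
    using c(2) that unfolding kdiff_alternate[OF that]
    by (auto simp: cycle_mod_def minus_one_power_iff intro: monomial_span_uminus)
  then have "kmult (kdiff n Var ?c) G \<sigma> \<in> monomial_span U"
    using s by (intro monomial_span_kmult(1)[OF U _ G])
  moreover have "(-1) ^ card \<tau> * ((-1) ^ card \<tau> * c \<tau>) = c \<tau>" for \<tau>
    by (simp add: mult.assoc[symmetric] flip: power_mult_distrib)
  ultimately show "kdiff n Var (kmult ?c G) \<sigma> - kmult c (kdiff n Var G) \<sigma> \<in> monomial_span U"
    by (simp add: kdiff_kmult[OF s])
qed

text \<open>Vanishing of a product does not depend on representatives: the product expands into
  \<partial>F (\<partial>G + d) + c \<partial>G + c d, and the first two terms are boundaries
  because \<partial>G + d and c are cycles modulo the ideal.\<close>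

lemma boundary_mod_kmult_homologous:
  assumes U: "up_closed n U" and c: "c \<in> koszul_chains n" "cycle_mod n U c" and d: "d \<in> koszul_chains n" "cycle_mod n U d"
    and F: "F \<in> koszul_chains n" and G: "G \<in> koszul_chains n" and cd: "boundary_mod n U (kmult c d)"
  shows "boundary_mod n U (kmult (\<lambda>\<sigma>. kdiff n Var F \<sigma> + c \<sigma>) (\<lambda>\<sigma>. kdiff n Var G \<sigma> + d \<sigma>))"
proof -
  have "cycle_mod n U (\<lambda>\<sigma>. kdiff n Var G \<sigma> + d \<sigma>)"
    unfolding cycle_mod_def
  proof (intro allI impI)
    fix \<sigma> :: "nat set" assume s: "\<sigma> \<subseteq> {1..n}"
    then have "finite \<sigma>" using finite_subset by blast
    then show "kdiff n Var (\<lambda>\<sigma>. kdiff n Var G \<sigma> + d \<sigma>) \<sigma> \<in> monomial_span U"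
      using d(2) s by (simp add: kdiff_add kdiff_kdiff cycle_mod_def)
  qed
  then have 1: "boundary_mod n U (kmult (kdiff n Var F) (\<lambda>\<sigma>. kdiff n Var G \<sigma> + d \<sigma>))"
    by (intro boundary_mod_kmult_kdiff_left[OF U F] chains_add chains_kdiff G d)
  have 2: "boundary_mod n U (kmult c (kdiff n Var G))"
    by (rule boundary_mod_kmult_kdiff_right[OF U G c])
  have "kmult (\<lambda>\<sigma>. kdiff n Var F \<sigma> + c \<sigma>) (\<lambda>\<sigma>. kdiff n Var G \<sigma> + d \<sigma>) =
    (\<lambda>\<sigma>. kmult (kdiff n Var F) (\<lambda>\<sigma>. kdiff n Var G \<sigma> + d \<sigma>) \<sigma> + (kmult c (kdiff n Var G) \<sigma> + kmult c d \<sigma>))"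
    by (intro ext) (simp add: kmult_add_left kmult_add_right)
  then show ?thesis using boundary_mod_add[OF 1 boundary_mod_add[OF 2 cd]] by simp
qed


section \<open>Monomial chains\<close>

definition monomial_chain :: "nat set \<Rightarrow> (nat \<Rightarrow>\<^sub>0 nat) \<Rightarrow> nat set \<Rightarrow> 'k::field mpoly" where
  "monomial_chain \<sigma> m = (\<lambda>\<rho>. if \<rho> = \<sigma> then Poly_Mapping.single m 1 else 0)"

lemma chains_monomial_chain: "m \<in> exponents n \<Longrightarrow> monomial_chain \<sigma> m \<in> koszul_chains n"
  by (simp add: koszul_chains_def monomial_chain_def monomial_span_single)

text \<open>Up to sign, the boundary has the coefficient x_i x^m at \<open>\<sigma> - {i}\<close>.
  Distinct \<open>i\<close> in \<sigma> give distinct faces, so nothing cancels.\<close>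

lemma cycle_mod_monomial_chain:
  assumes \<sigma>: "\<sigma> \<subseteq> {1..n}"
  shows "cycle_mod n U (monomial_chain \<sigma> m :: nat set \<Rightarrow> 'k::field mpoly) \<longleftrightarrow>
    (\<forall>j\<in>\<sigma>. m + Poly_Mapping.single j 1 \<in> U)"
proof -
  have x: "Var j * monomial_chain \<sigma> m \<sigma> = (Poly_Mapping.single (m + Poly_Mapping.single j 1) 1 :: 'k mpoly)" for j
    by (simp add: Var_def monomial_chain_def mult_single add.commute)
  show ?thesis
  proof
    assume c: "cycle_mod n U (monomial_chain \<sigma> m :: nat set \<Rightarrow> 'k mpoly)"
    show "\<forall>j\<in>\<sigma>. m + Poly_Mapping.single j 1 \<in> U"
    proof
      fix i assume i: "i \<in> \<sigma>"
      let ?\<rho> = "\<sigma> - {i}"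
      have "kdiff n Var (monomial_chain \<sigma> m :: nat set \<Rightarrow> 'k mpoly) ?\<rho> =
        (\<Sum>j\<in>{i}. of_int (koszul_sgn ?\<rho> j) * (Var j * monomial_chain \<sigma> m (insert j ?\<rho>)))"
        unfolding kdiff_def by (rule sum.mono_neutral_right) (use i \<sigma> in \<open>auto simp: monomial_chain_def\<close>)
      also have "\<dots> = of_int (koszul_sgn ?\<rho> i) * (Var i * monomial_chain \<sigma> m \<sigma>)"
        by (simp add: insert_absorb[OF i])
      also have "\<dots> = of_int (koszul_sgn ?\<rho> i) * Poly_Mapping.single (m + Poly_Mapping.single i 1) 1"
        by (simp only: x)
      finally have "of_int (koszul_sgn ?\<rho> i) * Poly_Mapping.single (m + Poly_Mapping.single i 1) (1::'k) \<in> monomial_span U"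
        using c \<sigma> unfolding cycle_mod_def by (metis Diff_subset subset_trans)
      then have "of_int (koszul_sgn ?\<rho> i) * (of_int (koszul_sgn ?\<rho> i) *
          Poly_Mapping.single (m + Poly_Mapping.single i 1) (1::'k)) \<in> monomial_span U"
        by (rule monomial_span_sign[OF koszul_sgn_cases])
      moreover have "of_int (koszul_sgn ?\<rho> i) * (of_int (koszul_sgn ?\<rho> i) * f) = f" for f :: "'k mpoly"
        using koszul_sgn_cases[of ?\<rho> i] by auto
      ultimately show "m + Poly_Mapping.single i 1 \<in> U"
        by (simp add: monomial_span_single)
    qed
  next
    assume c: "\<forall>j\<in>\<sigma>. m + Poly_Mapping.single j 1 \<in> U"
    show "cycle_mod n U (monomial_chain \<sigma> m :: nat set \<Rightarrow> 'k mpoly)"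
      unfolding cycle_mod_def kdiff_def
    proof (intro allI impI monomial_span_sum monomial_span_sign[OF koszul_sgn_cases])
      fix \<rho> j
      show "Var j * monomial_chain \<sigma> m (insert j \<rho>) \<in> (monomial_span U :: 'k mpoly set)"
      proof (cases "insert j \<rho> = \<sigma>")
        case True
        then have "j \<in> \<sigma>" by auto
        then show ?thesis using c unfolding True x by (simp add: monomial_span_single)
      qed (simp add: monomial_chain_def)
    qed
  qed
qed

lemma kmult_monomial_chain:
  assumes "finite \<rho>"
  shows "kmult (monomial_chain \<sigma> a) (monomial_chain \<tau> b) \<rho> =
    (if \<sigma> \<inter> \<tau> = {} then of_int (wedge_sgn \<sigma> \<tau>) * monomial_chain (\<sigma> \<union> \<tau>) (a + b) \<rho> else (0 :: 'k::field mpoly))"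
proof -
  have "kmult (monomial_chain \<sigma> a) (monomial_chain \<tau> b) \<rho> =
      (\<Sum>\<alpha>\<in>Pow \<rho>. if \<alpha> = \<sigma> then of_int (wedge_sgn \<sigma> (\<rho> - \<sigma>)) *
        (Poly_Mapping.single a 1 * monomial_chain \<tau> b (\<rho> - \<sigma>)) else (0 :: 'k mpoly))"
    unfolding kmult_def by (intro sum.cong refl) (auto simp: monomial_chain_def)
  also have "\<dots> = (if \<sigma> \<subseteq> \<rho> then of_int (wedge_sgn \<sigma> (\<rho> - \<sigma>)) *
        (Poly_Mapping.single a 1 * monomial_chain \<tau> b (\<rho> - \<sigma>)) else 0)"
    using assms by simp
  also have "\<dots> = (if \<sigma> \<inter> \<tau> = {} then of_int (wedge_sgn \<sigma> \<tau>) * monomial_chain (\<sigma> \<union> \<tau>) (a + b) \<rho> else 0)"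
  proof (cases "\<sigma> \<inter> \<tau> = {} \<and> \<rho> = \<sigma> \<union> \<tau>")
    case True
    then have "\<rho> - \<sigma> = \<tau>" "\<sigma> \<subseteq> \<rho>" by auto
    then show ?thesis using True by (simp add: monomial_chain_def mult_single)
  next
    case False
    then have "\<not> (\<sigma> \<subseteq> \<rho> \<and> \<rho> - \<sigma> = \<tau>)" by auto
    then show ?thesis using False by (auto simp: monomial_chain_def)
  qed
  finally show ?thesis .
qed

lemma boundary_mod_kmult_monomial_chain:
  assumes U: "up_closed n U" and \<sigma>: "\<sigma> \<subseteq> {1..n}" "\<sigma> \<noteq> {}" and \<tau>: "\<tau> \<subseteq> {1..n}"
    and a: "a \<in> exponents n" and b: "b \<in> exponents n"
  shows "boundary_mod n U (kmult (monomial_chain \<sigma> a) (monomial_chain \<tau> b) :: nat set \<Rightarrow> 'k::field mpoly) \<longleftrightarrow>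
    (\<sigma> \<inter> \<tau> = {} \<longrightarrow> a + b \<in> boundary_exponents TYPE('k) n U (\<sigma> \<union> \<tau>))"
proof -
  have fin: "finite \<rho>" if "\<rho> \<subseteq> {1..n}" for \<rho> :: "nat set" using that finite_subset by blast
  show ?thesis
  proof (cases "\<sigma> \<inter> \<tau> = {}")
    case True
    have "boundary_mod n U (kmult (monomial_chain \<sigma> a) (monomial_chain \<tau> b) :: nat set \<Rightarrow> 'k mpoly) \<longleftrightarrow>
        boundary_mod n U (\<lambda>\<rho>. of_int (wedge_sgn \<sigma> \<tau>) * (monomial_chain (\<sigma> \<union> \<tau>) (a + b) \<rho> :: 'k mpoly))"
      using True by (intro boundary_mod_cong) (simp add: kmult_monomial_chain fin)
    also have "\<dots> \<longleftrightarrow> boundary_mod n U (monomial_chain (\<sigma> \<union> \<tau>) (a + b) :: nat set \<Rightarrow> 'k mpoly)"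
      by (rule boundary_mod_sign[OF wedge_sgn_cases])
    also have "\<dots> \<longleftrightarrow> a + b \<in> boundary_exponents TYPE('k) n U (\<sigma> \<union> \<tau>)"
      unfolding monomial_chain_def
      by (rule boundary_mod_monomial_iff[OF U]) (use \<sigma> \<tau> a b in \<open>auto simp: exponents_add\<close>)
    finally show ?thesis using True by simp
  next
    case False
    have "boundary_mod n U (kmult (monomial_chain \<sigma> a) (monomial_chain \<tau> b) :: nat set \<Rightarrow> 'k mpoly) \<longleftrightarrow>
        boundary_mod n U (\<lambda>\<rho>. 0 :: 'k mpoly)"
      using False by (intro boundary_mod_cong) (simp add: kmult_monomial_chain fin)
    then show ?thesis using False by (simp add: boundary_mod_zero)
  qed
qed


section \<open>The Koszul complex of the quotient ring\<close>

lemma quot_mult: "mult (G Quot J) = rcoset_mult G J" and quot_zero: "zero (G Quot J) = J"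
  by (simp_all add: FactRing_def)

locale monomial_quotient =
  fixes n :: nat and U :: "(nat \<Rightarrow>\<^sub>0 nat) set" and I :: "'k::field mpoly set"
  assumes up: "up_closed n U" and I_eq: "I = monomial_span U"
begin

abbreviation "S \<equiv> poly_ring n :: 'k mpoly ring"
abbreviation "R \<equiv> quot_ring n I"
abbreviation "P \<equiv> monomial_span (exponents n) :: 'k mpoly set"
abbreviation "K \<equiv> koszul_algebra R n"
abbreviation "X \<equiv> var_residue n I"
abbreviation "B \<equiv> koszul_boundaries R n X"

text \<open>The bridge from polynomial chains to the Koszul algebra over S/I; the restriction
  produces the extensional functions of its carrier.\<close>

definition chain_class :: "(nat set \<Rightarrow> 'k mpoly) \<Rightarrow> nat set \<Rightarrow> 'k mpoly set" where
  "chain_class c = (\<lambda>\<rho>\<in>Pow {1..n}. residue n I (c \<rho>))"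

lemma ideal_I: "ideal I S"
  using ideal_monomial_span[OF up] by (simp add: I_eq)

lemma ring_R: "ring R"
  using ideal.quotient_is_ring[OF ideal_I] .

lemma residue_hom: "residue n I \<in> ring_hom S R"
proof -
  have "residue n I = (+>\<^bsub>S\<^esub>) I" by (rule ext) (simp add: residue_def)
  then show ?thesis using ideal.rcos_ring_hom[OF ideal_I] by simp
qed

lemma residue_closed: "f \<in> P \<Longrightarrow> residue n I f \<in> carrier R"
  using ring_hom_closed[OF residue_hom] by simp

lemma residue_add: "f \<in> P \<Longrightarrow> g \<in> P \<Longrightarrow> residue n I f \<oplus>\<^bsub>R\<^esub> residue n I g = residue n I (f + g)"
  using ring_hom_add[OF residue_hom, of f g] by simp

lemma residue_mult: "f \<in> P \<Longrightarrow> g \<in> P \<Longrightarrow> residue n I f \<otimes>\<^bsub>R\<^esub> residue n I g = residue n I (f * g)"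
  using ring_hom_mult[OF residue_hom, of f g] by simp

lemma residue_zero: "residue n I 0 = \<zero>\<^bsub>R\<^esub>"
  using ring_hom_zero[OF residue_hom ring_poly_ring ring_R] by simp

lemma residue_eq_iff:
  assumes "f \<in> P" "g \<in> P"
  shows "residue n I f = residue n I g \<longleftrightarrow> f - g \<in> monomial_span U"
proof -
  interpret S: ring S by (rule ring_poly_ring)
  show ?thesis
    using S.quotient_eq_iff_same_a_r_cos[OF ideal_I, of f g] assms
    by (simp add: residue_def a_minus_def poly_ring_a_inv I_eq)
qed

lemma residue_surj:
  assumes "z \<in> carrier R"
  shows "\<exists>f\<in>P. z = residue n I f"
  using assms by (auto simp: FactRing_def A_RCOSETS_def' residue_def)

lemma residue_finsum:
  assumes "\<And>i. i \<in> A \<Longrightarrow> f i \<in> P"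
  shows "(\<Oplus>\<^bsub>R\<^esub>i\<in>A. residue n I (f i)) = residue n I (sum f A)"
proof -
  interpret R: ring R by (rule ring_R)
  show ?thesis using assms
  proof (induction A rule: infinite_finite_induct)
    case (insert i A)
    then show ?case by (simp add: Pi_iff residue_closed residue_add monomial_span_sum)
  qed (simp_all add: residue_zero)
qed

lemma residue_sign:
  fixes s :: int
  assumes "s = 1 \<or> s = -1" "f \<in> P"
  shows "add_pow R s (residue n I f) = residue n I (of_int s * f)"
proof -
  interpret R: ring R by (rule ring_R)
  have one: "add_pow R (1::int) (residue n I f) = residue n I f"
    using R.add.int_pow_1[OF residue_closed[OF assms(2)]] .
  have "add_pow R (- 1::int) (residue n I f) = \<ominus>\<^bsub>R\<^esub> residue n I f"
    using R.add.int_pow_neg[OF residue_closed[OF assms(2)], of 1] one by simp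
  also have "\<dots> = residue n I (- f)"
    using assms(2) by (intro R.minus_equality)
      (simp_all add: residue_closed monomial_span_uminus residue_add residue_zero)
  finally show ?thesis using assms(1) one by auto
qed

section \<open>Koszul chains over the quotient as residues of polynomial chains\<close>

lemma carrier_K: "carrier K = chain_class ` koszul_chains n"
proof (intro equalityI subsetI)
  fix z assume "z \<in> carrier K"
  then have z: "z \<in> Pow {1..n} \<rightarrow>\<^sub>E carrier R" by (simp add: koszul_algebra_def)
  then have "\<forall>\<rho>\<in>Pow {1..n}. \<exists>f. f \<in> P \<and> z \<rho> = residue n I f"
    using residue_surj by (metis PiE_mem)
  then obtain c where c: "\<forall>\<rho>\<in>Pow {1..n}. c \<rho> \<in> P \<and> z \<rho> = residue n I (c \<rho>)" by metis
  have "z = chain_class c"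
    unfolding chain_class_def using z c by (intro ext) (auto simp: PiE_def extensional_def)
  then show "z \<in> chain_class ` koszul_chains n" using c by (auto simp: koszul_chains_def)
next
  fix z assume "z \<in> chain_class ` koszul_chains n"
  then obtain c where c: "c \<in> koszul_chains n" and z: "z = chain_class c" by auto
  have "residue n I (c \<rho>) \<in> carrier R" if "\<rho> \<in> Pow {1..n}" for \<rho>
    using c that by (intro residue_closed) (simp add: koszul_chains_def)
  then show "z \<in> carrier K"
    unfolding z koszul_algebra_def chain_class_def by (simp only: restrict_PiE_iff partial_object.simps) blast
qed

lemma chain_class_eq_iff:
  assumes "c \<in> koszul_chains n" "d \<in> koszul_chains n"
  shows "chain_class c = chain_class d \<longleftrightarrow> (\<forall>\<sigma>\<subseteq>{1..n}. c \<sigma> - d \<sigma> \<in> monomial_span U)"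
proof -
  have "chain_class c = chain_class d \<longleftrightarrow> (\<forall>\<sigma>\<subseteq>{1..n}. residue n I (c \<sigma>) = residue n I (d \<sigma>))"
    unfolding chain_class_def by (auto simp: fun_eq_iff restrict_def)
  then show ?thesis using assms residue_eq_iff by (auto simp: koszul_chains_def)
qed

lemma chain_class_zero: "\<zero>\<^bsub>K\<^esub> = chain_class (\<lambda>_. 0)"
  by (simp add: koszul_algebra_def chain_class_def residue_zero)

lemma chain_class_add:
  "c \<in> koszul_chains n \<Longrightarrow> d \<in> koszul_chains n \<Longrightarrow> chain_class c \<oplus>\<^bsub>K\<^esub> chain_class d = chain_class (\<lambda>\<sigma>. c \<sigma> + d \<sigma>)"
  by (auto simp: koszul_algebra_def chain_class_def koszul_chains_def residue_add intro!: restrict_ext)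

lemma chain_class_mult:
  assumes "c \<in> koszul_chains n" "d \<in> koszul_chains n"
  shows "chain_class c \<otimes>\<^bsub>K\<^esub> chain_class d = chain_class (kmult c d)"
proof -
  interpret R: ring R by (rule ring_R)
  have "(\<Oplus>\<^bsub>R\<^esub>\<sigma>\<in>Pow \<rho>. add_pow R (wedge_sgn \<sigma> (\<rho> - \<sigma>)) (chain_class c \<sigma> \<otimes>\<^bsub>R\<^esub> chain_class d (\<rho> - \<sigma>))) =
      residue n I (kmult c d \<rho>)" if \<rho>: "\<rho> \<subseteq> {1..n}" for \<rho>
  proof -
    have cd: "c \<sigma> \<in> P" "d (\<rho> - \<sigma>) \<in> P" "c \<sigma> * d (\<rho> - \<sigma>) \<in> P" "\<sigma> \<subseteq> {1..n}" "\<rho> - \<sigma> \<subseteq> {1..n}" if "\<sigma> \<in> Pow \<rho>" for \<sigma>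
    proof -
      show s: "\<sigma> \<subseteq> {1..n}" "\<rho> - \<sigma> \<subseteq> {1..n}" using that \<rho> by auto
      then show "c \<sigma> \<in> P" "d (\<rho> - \<sigma>) \<in> P" using assms by (simp_all add: koszul_chains_def)
      then show "c \<sigma> * d (\<rho> - \<sigma>) \<in> P" by (rule monomial_span_mult_right[OF up_closed_exponents])
    qed
    have "(\<Oplus>\<^bsub>R\<^esub>\<sigma>\<in>Pow \<rho>. add_pow R (wedge_sgn \<sigma> (\<rho> - \<sigma>)) (chain_class c \<sigma> \<otimes>\<^bsub>R\<^esub> chain_class d (\<rho> - \<sigma>))) =
        (\<Oplus>\<^bsub>R\<^esub>\<sigma>\<in>Pow \<rho>. residue n I (of_int (wedge_sgn \<sigma> (\<rho> - \<sigma>)) * (c \<sigma> * d (\<rho> - \<sigma>))))"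
      using cd by (intro R.finsum_cong')
        (auto simp: chain_class_def residue_mult residue_sign[OF wedge_sgn_cases]
          intro!: residue_closed monomial_span_sign[OF wedge_sgn_cases])
    also have "\<dots> = residue n I (kmult c d \<rho>)"
      unfolding kmult_def using cd by (intro residue_finsum monomial_span_sign[OF wedge_sgn_cases]) auto
    finally show ?thesis .
  qed
  then show ?thesis
    unfolding koszul_algebra_def monoid.simps
    by (simp add: chain_class_def[of "kmult c d"] cong: restrict_cong)
qed

lemma chain_class_diff:
  assumes "c \<in> koszul_chains n"
  shows "koszul_diff R n X (chain_class c) = chain_class (kdiff n Var c)"
proof -
  interpret R: ring R by (rule ring_R)
  have "(\<Oplus>\<^bsub>R\<^esub>j\<in>{1..n} - \<rho>. add_pow R (koszul_sgn (insert j \<rho>) j) (X j \<otimes>\<^bsub>R\<^esub> chain_class c (insert j \<rho>))) =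
      residue n I (kdiff n Var c \<rho>)" if \<rho>: "\<rho> \<subseteq> {1..n}" for \<rho>
  proof -
    have c: "c (insert j \<rho>) \<in> P" "Var j \<in> P" "Var j * c (insert j \<rho>) \<in> P" "insert j \<rho> \<subseteq> {1..n}"
      if "j \<in> {1..n} - \<rho>" for j
    proof -
      show s: "insert j \<rho> \<subseteq> {1..n}" using that \<rho> by auto
      then show "c (insert j \<rho>) \<in> P" "Var j \<in> P" using assms that by (auto simp: koszul_chains_def intro: monomial_span_Var)
      then show "Var j * c (insert j \<rho>) \<in> P" by (intro monomial_span_mult_right(1)[OF up_closed_exponents])
    qed
    have "(\<Oplus>\<^bsub>R\<^esub>j\<in>{1..n} - \<rho>. add_pow R (koszul_sgn (insert j \<rho>) j) (X j \<otimes>\<^bsub>R\<^esub> chain_class c (insert j \<rho>))) =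
        (\<Oplus>\<^bsub>R\<^esub>j\<in>{1..n} - \<rho>. residue n I (of_int (koszul_sgn \<rho> j) * (Var j * c (insert j \<rho>))))"
      using c by (intro R.finsum_cong')
        (auto simp: chain_class_def var_residue_def residue_mult koszul_sgn_insert_same residue_sign[OF koszul_sgn_cases]
          intro!: residue_closed monomial_span_sign[OF koszul_sgn_cases])
    also have "\<dots> = residue n I (kdiff n Var c \<rho>)"
      unfolding kdiff_def using c by (intro residue_finsum monomial_span_sign[OF koszul_sgn_cases]) auto
    finally show ?thesis .
  qed
  then show ?thesis
    unfolding koszul_diff_def by (simp add: chain_class_def[of "kdiff n Var c"] cong: restrict_cong)
qed

lemma chain_class_cycles:
  assumes "c \<in> koszul_chains n"
  shows "chain_class c \<in> koszul_cycles R n X \<longleftrightarrow> cycle_mod n U c"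
proof -
  have "chain_class c \<in> koszul_cycles R n X \<longleftrightarrow> chain_class (kdiff n Var c) = chain_class (\<lambda>_. 0)"
    using assms by (simp add: koszul_cycles_def carrier_K chain_class_diff chain_class_zero)
  then show ?thesis
    using chain_class_eq_iff[OF chains_kdiff[OF assms] chains_zero] by (simp add: cycle_mod_def)
qed

lemma boundaries_eq: "B = (\<lambda>F. chain_class (kdiff n Var F)) ` koszul_chains n"
  unfolding koszul_boundaries_def carrier_K image_image by (intro image_cong refl chain_class_diff)

lemma chain_class_boundaries:
  assumes "c \<in> koszul_chains n"
  shows "chain_class c \<in> B \<longleftrightarrow> boundary_mod n U c"
proof -
  have "chain_class c \<in> B \<longleftrightarrow> (\<exists>F\<in>koszul_chains n. chain_class (kdiff n Var F) = chain_class c)"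
    unfolding boundaries_eq image_iff by (simp only: eq_commute)
  also have "\<dots> \<longleftrightarrow> boundary_mod n U c"
    using chain_class_eq_iff[OF chains_kdiff assms] by (auto simp: boundary_mod_def koszul_chains_def)
  finally show ?thesis .
qed

section \<open>Homology classes and their products\<close>

lemma homology_class_eq:
  assumes "c \<in> koszul_chains n"
  shows "homology_class R n X (chain_class c) = {chain_class (\<lambda>\<sigma>. kdiff n Var F \<sigma> + c \<sigma>) | F. F \<in> koszul_chains n}"
proof -
  have "homology_class R n X (chain_class c) = {chain_class (kdiff n Var F) \<oplus>\<^bsub>K\<^esub> chain_class c | F. F \<in> koszul_chains n}"
    unfolding homology_class_def a_r_coset_def' boundaries_eq by auto
  also have "\<dots> = {chain_class (\<lambda>\<sigma>. kdiff n Var F \<sigma> + c \<sigma>) | F. F \<in> koszul_chains n}"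
  proof -
    have "chain_class (kdiff n Var F) \<oplus>\<^bsub>K\<^esub> chain_class c = chain_class (\<lambda>\<sigma>. kdiff n Var F \<sigma> + c \<sigma>)"
      if "F \<in> koszul_chains n" for F
      using chain_class_add[OF chains_kdiff[OF that] assms] .
    then show ?thesis by (intro Collect_cong ex_cong1) auto
  qed
  finally show ?thesis .
qed

lemma homology_class_boundary:
  assumes c: "c \<in> koszul_chains n" "boundary_mod n U c"
  shows "homology_class R n X (chain_class c) = B"
proof (intro equalityI subsetI)
  fix z assume "z \<in> homology_class R n X (chain_class c)"
  then obtain F where F: "F \<in> koszul_chains n" and z: "z = chain_class (\<lambda>\<sigma>. kdiff n Var F \<sigma> + c \<sigma>)"
    by (auto simp: homology_class_eq[OF c(1)])
  show "z \<in> B" unfolding z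
    using F c by (simp add: chain_class_boundaries chains_add chains_kdiff boundary_mod_add boundary_mod_kdiff)
next
  fix z assume "z \<in> B"
  then obtain F where F: "F \<in> koszul_chains n" and z: "z = chain_class (kdiff n Var F)"
    by (auto simp: boundaries_eq)
  obtain G where G: "G \<in> koszul_chains n" "\<And>\<sigma>. \<sigma> \<subseteq> {1..n} \<Longrightarrow> kdiff n Var G \<sigma> - c \<sigma> \<in> monomial_span U"
    using c(2) by (metis boundary_modE)
  \<comment> \<open>Modulo the ideal \<open>c\<close> is the boundary of \<open>G\<close>, so
    \<partial>F is \<partial>(F - G) plus c.\<close>
  let ?H = "\<lambda>\<sigma>. F \<sigma> + - G \<sigma>"
  have H: "?H \<in> koszul_chains n" using chains_add[OF F chains_uminus[OF G(1)]] .
  have "z = chain_class (\<lambda>\<sigma>. kdiff n Var ?H \<sigma> + c \<sigma>)"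
    unfolding z
  proof (subst chain_class_eq_iff)
    show "\<forall>\<sigma>\<subseteq>{1..n}. kdiff n Var F \<sigma> - (kdiff n Var ?H \<sigma> + c \<sigma>) \<in> monomial_span U"
    proof (intro allI impI)
      fix \<sigma> :: "nat set" assume "\<sigma> \<subseteq> {1..n}"
      then have "kdiff n Var G \<sigma> - c \<sigma> \<in> monomial_span U" by (rule G(2))
      then show "kdiff n Var F \<sigma> - (kdiff n Var ?H \<sigma> + c \<sigma>) \<in> monomial_span U"
        by (simp only: kdiff_add kdiff_uminus) simp
    qed
  qed (use F H c(1) in \<open>auto intro!: chains_add chains_kdiff\<close>)
  then show "z \<in> homology_class R n X (chain_class c)"
    using H by (auto simp: homology_class_eq[OF c(1)])
qed

text \<open>The product of two cosets is the union of the cosets of all products of representatives.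
  If \<open>kmult c d\<close> is a boundary, so are all the other products, and the union is the
  zero coset. Conversely the union contains the class of \<open>kmult c d\<close>.\<close>

lemma homology_product_zero_iff:
  assumes c: "c \<in> koszul_chains n" "cycle_mod n U c" and d: "d \<in> koszul_chains n" "cycle_mod n U d"
  shows "homology_class R n X (chain_class c) \<otimes>\<^bsub>koszul_homology R n X\<^esub> homology_class R n X (chain_class d) =
      \<zero>\<^bsub>koszul_homology R n X\<^esub> \<longleftrightarrow> boundary_mod n U (kmult c d)"
proof -
  let ?c = "\<lambda>F \<sigma>. kdiff n Var F \<sigma> + c \<sigma>" and ?d = "\<lambda>G \<sigma>. kdiff n Var G \<sigma> + d \<sigma>"
  \<comment> \<open>A coset only uses the addition, which the change of carrier leaves
    alone.\<close>
  have coset: "B +>\<^bsub>K\<lparr>carrier := koszul_cycles R n X\<rparr>\<^esub> z = homology_class R n X z" for z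
    by (simp add: homology_class_def a_r_coset_def')
  have ch: "?c F \<in> koszul_chains n" "?d F \<in> koszul_chains n" if "F \<in> koszul_chains n" for F
    using that c d by (auto intro!: chains_add chains_kdiff)
  have prod: "homology_class R n X (chain_class c) \<otimes>\<^bsub>koszul_homology R n X\<^esub> homology_class R n X (chain_class d) =
      (\<Union>F\<in>koszul_chains n. \<Union>G\<in>koszul_chains n. homology_class R n X (chain_class (kmult (?c F) (?d G))))"
  proof -
    have "homology_class R n X (chain_class c) \<otimes>\<^bsub>koszul_homology R n X\<^esub> homology_class R n X (chain_class d) =
        (\<Union>a\<in>homology_class R n X (chain_class c). \<Union>b\<in>homology_class R n X (chain_class d).
          homology_class R n X (a \<otimes>\<^bsub>K\<^esub> b))"
      by (simp add: koszul_homology_def quot_mult rcoset_mult_def coset)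
    also have "\<dots> = (\<Union>F\<in>koszul_chains n. \<Union>G\<in>koszul_chains n. homology_class R n X (chain_class (?c F) \<otimes>\<^bsub>K\<^esub> chain_class (?d G)))"
      unfolding homology_class_eq[OF c(1)] homology_class_eq[OF d(1)] by blast
    also have "\<dots> = (\<Union>F\<in>koszul_chains n. \<Union>G\<in>koszul_chains n. homology_class R n X (chain_class (kmult (?c F) (?d G))))"
      using ch by (intro SUP_cong refl) (simp add: chain_class_mult)
    finally show ?thesis .
  qed
  have zero: "\<zero>\<^bsub>koszul_homology R n X\<^esub> = B"
    by (simp add: koszul_homology_def quot_zero)
  show ?thesis unfolding prod zero
  proof
    assume bd: "boundary_mod n U (kmult c d)"
    have "homology_class R n X (chain_class (kmult (?c F) (?d G))) = B" if "F \<in> koszul_chains n" "G \<in> koszul_chains n" for F G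
      using that bd by (intro homology_class_boundary chains_kmult ch boundary_mod_kmult_homologous[OF up c d])
    moreover have "(koszul_chains n :: (nat set \<Rightarrow> 'k mpoly) set) \<noteq> {}" using chains_zero by blast
    ultimately show "(\<Union>F\<in>koszul_chains n. \<Union>G\<in>koszul_chains n. homology_class R n X (chain_class (kmult (?c F) (?d G)))) = B"
      by simp
  next
    assume eq: "(\<Union>F\<in>koszul_chains n. \<Union>G\<in>koszul_chains n. homology_class R n X (chain_class (kmult (?c F) (?d G)))) = B"
    \<comment> \<open>Zero primitives select the representatives \<open>c\<close> and
      \<open>d\<close> themselves.\<close>
    let ?z = "\<lambda>_ :: nat set. 0 :: 'k mpoly"
    have k0: "kdiff n Var ?z = ?z" by (intro ext) (simp add: kdiff_def)
    have "chain_class (\<lambda>\<sigma>. kdiff n Var ?z \<sigma> + kmult c d \<sigma>) \<in> homology_class R n X (chain_class (kmult c d))"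
      unfolding homology_class_eq[OF chains_kmult[OF c(1) d(1)]] using chains_zero by blast
    then have "chain_class (kmult c d) \<in> homology_class R n X (chain_class (kmult (?c ?z) (?d ?z)))"
      by (simp add: k0)
    then have "chain_class (kmult c d) \<in> B" using eq chains_zero by blast
    then show "boundary_mod n U (kmult c d)"
      using chain_class_boundaries[OF chains_kmult[OF c(1) d(1)]] by simp
  qed
qed

section \<open>Reduction of both conditions to exponents\<close>

lemma monomial_cycles_eq:
  "monomial_cycles n I p = {chain_class (monomial_chain \<sigma> m) | \<sigma> m. \<sigma> \<subseteq> {1..n} \<and> card \<sigma> = p \<and>
    m \<in> exponents n \<and> (\<forall>j\<in>\<sigma>. m + Poly_Mapping.single j 1 \<in> U)}"
proof -
  have elem: "koszul_elem R n (residue n I (Poly_Mapping.single m 1)) \<sigma> = chain_class (monomial_chain \<sigma> m)" for \<sigma> m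
    unfolding koszul_elem_def chain_class_def monomial_chain_def
    by (intro restrict_ext) (simp add: residue_zero)
  have "monomial_cycles n I p = {chain_class (monomial_chain \<sigma> m) | \<sigma> m. \<sigma> \<subseteq> {1..n} \<and> card \<sigma> = p \<and>
    m \<in> exponents n \<and> chain_class (monomial_chain \<sigma> m) \<in> koszul_cycles R n X}"
    unfolding monomial_cycles_def monomials_def exponents_def by (auto simp: elem) (metis elem)+
  then show ?thesis
    by (simp only: chain_class_cycles chains_monomial_chain cycle_mod_monomial_chain cong: conj_cong)
qed

text \<open>Degree at least one means a nonempty index set, and overlapping index sets multiply to
  zero, so only disjoint pairs impose a condition.\<close>

lemma products_vanish_iff:
  "(\<forall>p \<ge> 1. \<forall>q \<ge> 1. \<forall>z \<in> monomial_cycles n I p. \<forall>w \<in> monomial_cycles n I q.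
      homology_class R n X z \<otimes>\<^bsub>koszul_homology R n X\<^esub> homology_class R n X w = \<zero>\<^bsub>koszul_homology R n X\<^esub>)
  \<longleftrightarrow> (\<forall>\<sigma> \<tau> a b. \<sigma> \<subseteq> {1..n} \<and> \<tau> \<subseteq> {1..n} \<and> \<sigma> \<noteq> {} \<and> \<tau> \<noteq> {} \<and> \<sigma> \<inter> \<tau> = {} \<and>
      a \<in> exponents n \<and> b \<in> exponents n \<and> (\<forall>j\<in>\<sigma>. a + Poly_Mapping.single j 1 \<in> U) \<and>
      (\<forall>j\<in>\<tau>. b + Poly_Mapping.single j 1 \<in> U) \<longrightarrow> a + b \<in> boundary_exponents TYPE('k) n U (\<sigma> \<union> \<tau>))"
    (is "?L \<longleftrightarrow> ?R")
proof -
  let ?cyc = "\<lambda>\<sigma> a. \<sigma> \<subseteq> {1..n} \<and> a \<in> exponents n \<and> (\<forall>j\<in>\<sigma>. a + Poly_Mapping.single j 1 \<in> U)"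
  have card: "1 \<le> card \<sigma> \<longleftrightarrow> \<sigma> \<noteq> {}" if "\<sigma> \<subseteq> {1..n}" for \<sigma>
    using that finite_subset[of \<sigma> "{1..n}"] by (simp add: Suc_le_eq card_gt_0_iff)
  have prod: "homology_class R n X (chain_class (monomial_chain \<sigma> a)) \<otimes>\<^bsub>koszul_homology R n X\<^esub>
        homology_class R n X (chain_class (monomial_chain \<tau> b)) = \<zero>\<^bsub>koszul_homology R n X\<^esub> \<longleftrightarrow>
      (\<sigma> \<inter> \<tau> = {} \<longrightarrow> a + b \<in> boundary_exponents TYPE('k) n U (\<sigma> \<union> \<tau>))"
    if "?cyc \<sigma> a" "?cyc \<tau> b" "\<sigma> \<noteq> {}" for \<sigma> \<tau> a b
    using that by (subst homology_product_zero_iff)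
      (auto simp: chains_monomial_chain cycle_mod_monomial_chain boundary_mod_kmult_monomial_chain[OF up])
  have "?L \<longleftrightarrow> (\<forall>\<sigma> \<tau> a b. ?cyc \<sigma> a \<and> ?cyc \<tau> b \<and> 1 \<le> card \<sigma> \<and> 1 \<le> card \<tau> \<longrightarrow>
      homology_class R n X (chain_class (monomial_chain \<sigma> a)) \<otimes>\<^bsub>koszul_homology R n X\<^esub>
        homology_class R n X (chain_class (monomial_chain \<tau> b)) = \<zero>\<^bsub>koszul_homology R n X\<^esub>)"
    unfolding monomial_cycles_eq by blast
  also have "\<dots> \<longleftrightarrow> ?R"
  proof (intro iff_allI)
    fix \<sigma> \<tau> a b
    show "(?cyc \<sigma> a \<and> ?cyc \<tau> b \<and> 1 \<le> card \<sigma> \<and> 1 \<le> card \<tau> \<longrightarrow>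
      homology_class R n X (chain_class (monomial_chain \<sigma> a)) \<otimes>\<^bsub>koszul_homology R n X\<^esub>
        homology_class R n X (chain_class (monomial_chain \<tau> b)) = \<zero>\<^bsub>koszul_homology R n X\<^esub>) \<longleftrightarrow>
      (\<sigma> \<subseteq> {1..n} \<and> \<tau> \<subseteq> {1..n} \<and> \<sigma> \<noteq> {} \<and> \<tau> \<noteq> {} \<and> \<sigma> \<inter> \<tau> = {} \<and>
      a \<in> exponents n \<and> b \<in> exponents n \<and> (\<forall>j\<in>\<sigma>. a + Poly_Mapping.single j 1 \<in> U) \<and>
      (\<forall>j\<in>\<tau>. b + Poly_Mapping.single j 1 \<in> U) \<longrightarrow> a + b \<in> boundary_exponents TYPE('k) n U (\<sigma> \<union> \<tau>))"
      using card[of \<sigma>] card[of \<tau>] prod[of \<sigma> a \<tau> b] by argo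
  qed
  finally show ?thesis .
qed

text \<open>For a fixed disjoint pair this is the condition in \<open>products_vanish_iff\<close>,
  because the monomials of the colon ideals are the coefficients of the monomial cycles.\<close>

lemma containment_iff:
  assumes "\<sigma> \<subseteq> {1..n}" "\<tau> \<subseteq> {1..n}"
  shows "colon S I (var_ideal n \<sigma>) \<cdot>\<^bsub>S\<^esub> colon S I (var_ideal n \<tau>) \<subseteq> boundary_ideal n I (\<sigma> \<union> \<tau>) \<longleftrightarrow>
    (\<forall>a b. a \<in> exponents n \<and> b \<in> exponents n \<and> (\<forall>j\<in>\<sigma>. a + Poly_Mapping.single j 1 \<in> U) \<and>
      (\<forall>j\<in>\<tau>. b + Poly_Mapping.single j 1 \<in> U) \<longrightarrow> a + b \<in> boundary_exponents TYPE('k) n U (\<sigma> \<union> \<tau>))"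
proof -
  have "\<sigma> \<union> \<tau> \<subseteq> {1..n}" using assms by simp
  then show ?thesis
    unfolding I_eq colon_var_ideal[OF up assms(1)] colon_var_ideal[OF up assms(2)]
    by (simp only: boundary_ideal_monomial_span[OF up] ideal_prod_monomial_span_subset) blast
qed

end

text \<open>A permutation enters the criterion only through the images of two blocks. Bijections of
  these blocks onto \<sigma> and \<tau>, and of the remaining indices onto the complement, exist by
  cardinality and are glued.\<close>

lemma exists_permutation_splitting:
  assumes \<sigma>: "\<sigma> \<subseteq> {1..n}" and \<tau>: "\<tau> \<subseteq> {1..n}" and disj: "\<sigma> \<inter> \<tau> = {}"
  shows "\<exists>\<pi>. \<pi> permutes {1..n} \<and> \<pi> ` {1..card \<sigma>} = \<sigma> \<and> \<pi> ` {card \<sigma> + 1..card \<sigma> + card \<tau>} = \<tau>"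
proof -
  define q where "q = card \<sigma>"
  define p where "p = card \<sigma> + card \<tau>"
  have fin: "finite \<sigma>" "finite \<tau>" using \<sigma> \<tau> finite_subset by auto
  have card: "card (\<sigma> \<union> \<tau>) = p" using fin disj by (simp add: p_def card_Un_disjoint)
  have "card (\<sigma> \<union> \<tau>) \<le> card {1..n}" using \<sigma> \<tau> by (intro card_mono) auto
  then have pn: "p \<le> n" using card by simp
  have qp: "q \<le> p" by (simp add: q_def p_def)
  obtain f where f: "bij_betw f {1..q} \<sigma>"
    using fin finite_same_card_bij[of "{1..q}" \<sigma>] by (auto simp: q_def)
  obtain g where g: "bij_betw g {q+1..p} \<tau>"
    using fin finite_same_card_bij[of "{q+1..p}" \<tau>] by (auto simp: q_def p_def)
  have "card ({1..n} - (\<sigma> \<union> \<tau>)) = n - p" using card \<sigma> \<tau> fin by (subst card_Diff_subset) auto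
  then obtain h where h: "bij_betw h {p+1..n} ({1..n} - (\<sigma> \<union> \<tau>))"
    using finite_same_card_bij[of "{p+1..n}" "{1..n} - (\<sigma> \<union> \<tau>)"] by auto
  define \<pi> where "\<pi> i = (if i \<in> {1..q} then f i else if i \<in> {q+1..p} then g i
    else if i \<in> {p+1..n} then h i else i)" for i
  have 1: "bij_betw \<pi> {1..q} \<sigma>" using f by (rule bij_betw_cong[THEN iffD1, rotated]) (auto simp: \<pi>_def)
  have 2: "bij_betw \<pi> {q+1..p} \<tau>" using g by (rule bij_betw_cong[THEN iffD1, rotated]) (auto simp: \<pi>_def)
  have 3: "bij_betw \<pi> {p+1..n} ({1..n} - (\<sigma> \<union> \<tau>))"
    using h by (rule bij_betw_cong[THEN iffD1, rotated]) (use qp in \<open>auto simp: \<pi>_def\<close>)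
  have "bij_betw \<pi> (({1..q} \<union> {q+1..p}) \<union> {p+1..n}) ((\<sigma> \<union> \<tau>) \<union> ({1..n} - (\<sigma> \<union> \<tau>)))"
    by (intro bij_betw_combine 1 2 3) (use disj in auto)
  moreover have "({1..q} \<union> {q+1..p}) \<union> {p+1..n} = {1..n}" using qp pn by auto
  moreover have "(\<sigma> \<union> \<tau>) \<union> ({1..n} - (\<sigma> \<union> \<tau>)) = {1..n}" using \<sigma> \<tau> by auto
  ultimately have "bij_betw \<pi> {1..n} {1..n}" by simp
  then have "\<pi> permutes {1..n}"
    by (rule bij_imp_permutes) (use qp pn in \<open>auto simp: \<pi>_def\<close>)
  then show ?thesis using 1 2 by (intro exI[of _ \<pi>]) (simp add: bij_betw_def q_def p_def)
qed

theorem theorem1p4: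
  fixes n :: nat and I :: "'k::field mpoly set"
  assumes "monomial_ideal n I"
    and "I \<subseteq> var_ideal n {1..n} \<cdot>\<^bsub>poly_ring n\<^esub> var_ideal n {1..n}"
  shows "(\<forall>p \<ge> 1. \<forall>q \<ge> 1. \<forall>z \<in> monomial_cycles n I p. \<forall>w \<in> monomial_cycles n I q.
      homology_class (quot_ring n I) n (var_residue n I) z
        \<otimes>\<^bsub>koszul_homology (quot_ring n I) n (var_residue n I)\<^esub>
      homology_class (quot_ring n I) n (var_residue n I) w
        = \<zero>\<^bsub>koszul_homology (quot_ring n I) n (var_residue n I)\<^esub>)
    \<longleftrightarrow>
    (\<forall>p q \<pi>. 2 \<le> p \<and> p \<le> n \<and> 1 \<le> q \<and> q < p \<and> \<pi> permutes {1..n} \<longrightarrow>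
      colon (poly_ring n) I (var_ideal n (\<pi> ` {1..q}))
        \<cdot>\<^bsub>poly_ring n\<^esub> colon (poly_ring n) I (var_ideal n (\<pi> ` {q+1..p}))
      \<subseteq> boundary_ideal n I (\<pi> ` {1..p}))"
proof -
  obtain U where U: "up_closed n U" "I = monomial_span U"
    using assms(1) by (rule monomial_ideal_eq_monomial_span)
  interpret monomial_quotient n U I by unfold_locales (fact U)+
  \<comment> \<open>The condition attached to one pair of index sets; subset pairs and permutations
    are two ways of quantifying over it.\<close>
  define V where "V \<sigma> \<tau> \<longleftrightarrow> (\<forall>a b. a \<in> exponents n \<and> b \<in> exponents n \<and> (\<forall>j\<in>\<sigma>. a + Poly_Mapping.single j 1 \<in> U) \<and>
      (\<forall>j\<in>\<tau>. b + Poly_Mapping.single j 1 \<in> U) \<longrightarrow> a + b \<in> boundary_exponents TYPE('k) n U (\<sigma> \<union> \<tau>))"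
    for \<sigma> \<tau>
  have perm: "(\<forall>\<sigma> \<tau>. \<sigma> \<subseteq> {1..n} \<and> \<tau> \<subseteq> {1..n} \<and> \<sigma> \<noteq> {} \<and> \<tau> \<noteq> {} \<and> \<sigma> \<inter> \<tau> = {} \<longrightarrow> V \<sigma> \<tau>) \<longleftrightarrow>
    (\<forall>p q \<pi>. 2 \<le> p \<and> p \<le> n \<and> 1 \<le> q \<and> q < p \<and> \<pi> permutes {1..n} \<longrightarrow> V (\<pi> ` {1..q}) (\<pi> ` {q+1..p}))"
  proof (intro iffI allI impI)
    fix p q :: nat and \<pi> :: "nat \<Rightarrow> nat"
    assume V: "\<forall>\<sigma> \<tau>. \<sigma> \<subseteq> {1..n} \<and> \<tau> \<subseteq> {1..n} \<and> \<sigma> \<noteq> {} \<and> \<tau> \<noteq> {} \<and> \<sigma> \<inter> \<tau> = {} \<longrightarrow> V \<sigma> \<tau>"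
      and p: "2 \<le> p \<and> p \<le> n \<and> 1 \<le> q \<and> q < p \<and> \<pi> permutes {1..n}"
    then have img: "\<pi> ` {1..n} = {1..n}" and inj: "inj \<pi>"
      using permutes_image[of \<pi> "{1..n}"] permutes_inj[of \<pi> "{1..n}"] by simp_all
    have "\<pi> ` {1..q} \<subseteq> \<pi> ` {1..n}" "\<pi> ` {q+1..p} \<subseteq> \<pi> ` {1..n}"
      using p by (auto intro!: image_mono)
    moreover have "\<pi> ` {1..q} \<inter> \<pi> ` {q+1..p} = {}"
      by (subst image_Int[OF inj, symmetric]) auto
    ultimately show "V (\<pi> ` {1..q}) (\<pi> ` {q+1..p})" using V p unfolding img by auto
  next
    fix \<sigma> \<tau>
    assume V: "\<forall>p q \<pi>. 2 \<le> p \<and> p \<le> n \<and> 1 \<le> q \<and> q < p \<and> \<pi> permutes {1..n} \<longrightarrow> V (\<pi> ` {1..q}) (\<pi> ` {q+1..p})"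
      and s: "\<sigma> \<subseteq> {1..n} \<and> \<tau> \<subseteq> {1..n} \<and> \<sigma> \<noteq> {} \<and> \<tau> \<noteq> {} \<and> \<sigma> \<inter> \<tau> = {}"
    then obtain \<pi> where \<pi>: "\<pi> permutes {1..n}" "\<pi> ` {1..card \<sigma>} = \<sigma>" "\<pi> ` {card \<sigma> + 1..card \<sigma> + card \<tau>} = \<tau>"
      using exists_permutation_splitting by metis
    have fin: "finite \<sigma>" "finite \<tau>" using s finite_subset by auto
    then have c: "1 \<le> card \<sigma>" "1 \<le> card \<tau>" using s by (simp_all add: Suc_le_eq card_gt_0_iff)
    have "card (\<sigma> \<union> \<tau>) \<le> card {1..n}" using s by (intro card_mono) auto
    then have "card \<sigma> + card \<tau> \<le> n" using s fin by (simp add: card_Un_disjoint)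
    \<comment> \<open>With \<open>q = card \<sigma>\<close> and
      \<open>p = card \<sigma> + card \<tau>\<close>, nonemptiness of \<sigma> and \<tau> gives
      \<open>1 \<le> q\<close>, \<open>q < p\<close> and \<open>2 \<le> p\<close>; disjointness gave
      \<open>p \<le> n\<close>.\<close>
    then have "V (\<pi> ` {1..card \<sigma>}) (\<pi> ` {card \<sigma> + 1..card \<sigma> + card \<tau>})"
      using V[rule_format, of "card \<sigma> + card \<tau>" "card \<sigma>" \<pi>] c \<pi>(1) by simp
    then show "V \<sigma> \<tau>" by (simp only: \<pi>(2,3))
  qed
  have cont: "V (\<pi> ` {1..q}) (\<pi> ` {q+1..p}) \<longleftrightarrow> colon (poly_ring n) I (var_ideal n (\<pi> ` {1..q}))
        \<cdot>\<^bsub>poly_ring n\<^esub> colon (poly_ring n) I (var_ideal n (\<pi> ` {q+1..p})) \<subseteq> boundary_ideal n I (\<pi> ` {1..p})"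
    if p: "2 \<le> p \<and> p \<le> n \<and> 1 \<le> q \<and> q < p \<and> \<pi> permutes {1..n}" for p q \<pi>
  proof -
    have img: "\<pi> ` {1..n} = {1..n}" using p permutes_image[of \<pi>] by simp
    have "\<pi> ` {1..q} \<subseteq> \<pi> ` {1..n}" "\<pi> ` {q+1..p} \<subseteq> \<pi> ` {1..n}"
      using p by (auto intro!: image_mono)
    note sub = this[unfolded img]
    have "{1..p} = {1..q} \<union> {q+1..p}" using p by auto
    then have "\<pi> ` {1..p} = \<pi> ` {1..q} \<union> \<pi> ` {q+1..p}" by (simp only: image_Un)
    then show ?thesis unfolding V_def by (simp only: containment_iff[OF sub])
  qed
  have "(\<forall>\<sigma> \<tau>. \<sigma> \<subseteq> {1..n} \<and> \<tau> \<subseteq> {1..n} \<and> \<sigma> \<noteq> {} \<and> \<tau> \<noteq> {} \<and> \<sigma> \<inter> \<tau> = {} \<longrightarrow> V \<sigma> \<tau>) \<longleftrightarrow>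
    (\<forall>\<sigma> \<tau> a b. \<sigma> \<subseteq> {1..n} \<and> \<tau> \<subseteq> {1..n} \<and> \<sigma> \<noteq> {} \<and> \<tau> \<noteq> {} \<and> \<sigma> \<inter> \<tau> = {} \<and>
      a \<in> exponents n \<and> b \<in> exponents n \<and> (\<forall>j\<in>\<sigma>. a + Poly_Mapping.single j 1 \<in> U) \<and>
      (\<forall>j\<in>\<tau>. b + Poly_Mapping.single j 1 \<in> U) \<longrightarrow> a + b \<in> boundary_exponents TYPE('k) n U (\<sigma> \<union> \<tau>))"
    unfolding V_def by blast
  from trans[OF products_vanish_iff trans[OF this[symmetric] perm]] show ?thesis
    by (rule trans) (intro iff_allI imp_cong refl cont)
qed

end
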